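(* Let $\mathcal{F}$ be a class of simple finite graphs that is closed under taking subgraphs. Suppose that every $G\in\mathcal{F}$ satisfies $\chi''(G)\leq \Delta(G)+3$. Then Hadwiger's conjecture holds for every graph in $T(\mathcal{F})=\{T(G): G\in\mathcal{F}\}$, i.e. for every $G\in\mathcal{F}$ and every integer $t>0$, if $\chi(T(G))\geq t$ then $T(G)$ contains $K_t$ as a minor.
   Context: $\Delta(G)$ is the maximum degree of $G$. A total coloring of $G$ assigns colors to $V(G)\cup E(G)$ so that adjacent vertices, adjacent edges, and an edge and either of its endpoints always receive distinct colors; $\chi''(G)$ is the minimum number of colors in a total coloring. The total graph $T(G)$ has vertex set $V(G)\cup E(G)$, two elements being adjacent in $T(G)$ if they are adjacent vertices, adjacent edges (sharing an endpoint), or an edge and one of its endpoints in $G$. A graph $H$ is a minor of $G$ if a graph isomorphic to $H$ can be obtained from $G$ by vertex deletions, edge deletions and edge contractions. *)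

theory Defs
  imports Main
begin

datatype 'a graph = Graph (verts: "'a set") (edges: "'a set set")

definition simple_graph :: "'a graph \<Rightarrow> bool" where
  "simple_graph G \<longleftrightarrow> finite (verts G) \<and> (\<forall>e\<in>edges G. e \<subseteq> verts G \<and> card e = 2)"

definition subgraph :: "'a graph \<Rightarrow> 'a graph \<Rightarrow> bool" where
  "subgraph H G \<longleftrightarrow> simple_graph H \<and> verts H \<subseteq> verts G \<and> edges H \<subseteq> edges G"

definition subgraph_closed :: "'a graph set \<Rightarrow> bool" where
  "subgraph_closed F \<longleftrightarrow> (\<forall>G\<in>F. \<forall>H. subgraph H G \<longrightarrow> H \<in> F)"

definition degree :: "'a graph \<Rightarrow> 'a \<Rightarrow> nat" where
  "degree G v = card {e \<in> edges G. v \<in> e}"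

(* The inserted 0 only fixes the value for the graph without vertices. *)
definition max_degree :: "'a graph \<Rightarrow> nat" where
  "max_degree G = Max (insert 0 (degree G ` verts G))"

definition proper_coloring :: "'a graph \<Rightarrow> ('a \<Rightarrow> nat) \<Rightarrow> bool" where
  "proper_coloring G c \<longleftrightarrow> (\<forall>u\<in>verts G. \<forall>v\<in>verts G. {u, v} \<in> edges G \<longrightarrow> c u \<noteq> c v)"

definition chromatic_number :: "'a graph \<Rightarrow> nat" where
  "chromatic_number G = (LEAST k. \<exists>c. proper_coloring G c \<and> c ` verts G \<subseteq> {..<k})"

(* In V(G) \<union> E(G), a vertex v is represented by Inl v and an edge e by Inr e. *)
definition total_coloring :: "'a graph \<Rightarrow> ('a + 'a set \<Rightarrow> nat) \<Rightarrow> bool" where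
  "total_coloring G c \<longleftrightarrow>
     (\<forall>u\<in>verts G. \<forall>v\<in>verts G. {u, v} \<in> edges G \<longrightarrow> c (Inl u) \<noteq> c (Inl v)) \<and>
     (\<forall>e\<in>edges G. \<forall>f\<in>edges G. e \<noteq> f \<and> e \<inter> f \<noteq> {} \<longrightarrow> c (Inr e) \<noteq> c (Inr f)) \<and>
     (\<forall>e\<in>edges G. \<forall>v\<in>e. c (Inl v) \<noteq> c (Inr e))"

definition total_chromatic_number :: "'a graph \<Rightarrow> nat" where
  "total_chromatic_number G =
     (LEAST k. \<exists>c. total_coloring G c \<and> c ` (verts G <+> edges G) \<subseteq> {..<k})"

definition total_graph :: "'a graph \<Rightarrow> ('a + 'a set) graph" where
  "total_graph G = Graph (verts G <+> edges G)
     ({{Inl u, Inl v} | u v. {u, v} \<in> edges G} \<union>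
      {{Inr e, Inr f} | e f. e \<in> edges G \<and> f \<in> edges G \<and> e \<noteq> f \<and> e \<inter> f \<noteq> {}} \<union>
      {{Inl v, Inr e} | v e. e \<in> edges G \<and> v \<in> e})"

definition complete_graph :: "nat \<Rightarrow> nat graph" where
  "complete_graph t = Graph {..<t} {e. e \<subseteq> {..<t} \<and> card e = 2}"

definition isomorphic :: "'a graph \<Rightarrow> 'b graph \<Rightarrow> bool" where
  "isomorphic G H \<longleftrightarrow>
     (\<exists>f. bij_betw f (verts G) (verts H) \<and>
          (\<forall>u\<in>verts G. \<forall>v\<in>verts G. {u, v} \<in> edges G \<longleftrightarrow> {f u, f v} \<in> edges H))"

definition delete_vertex :: "'a graph \<Rightarrow> 'a \<Rightarrow> 'a graph" where
  "delete_vertex G v = Graph (verts G - {v}) {e \<in> edges G. v \<notin> e}"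

definition delete_edge :: "'a graph \<Rightarrow> 'a set \<Rightarrow> 'a graph" where
  "delete_edge G e = Graph (verts G) (edges G - {e})"

(* Contraction of the edge {u, v}: v is identified with u, the resulting loop is
   dropped, and parallel edges coincide because edges form a set. *)
definition contract_edge :: "'a graph \<Rightarrow> 'a \<Rightarrow> 'a \<Rightarrow> 'a graph" where
  "contract_edge G u v = Graph (verts G - {v}) ((`) (id(v := u)) ` (edges G - {{u, v}}))"

inductive minor_step :: "'a graph \<Rightarrow> 'a graph \<Rightarrow> bool" where
  del_vertex: "v \<in> verts G \<Longrightarrow> minor_step G (delete_vertex G v)"
| del_edge: "e \<in> edges G \<Longrightarrow> minor_step G (delete_edge G e)"
| contract: "{u, v} \<in> edges G \<Longrightarrow> minor_step G (contract_edge G u v)"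

definition has_minor :: "'a graph \<Rightarrow> 'b graph \<Rightarrow> bool" where
  "has_minor G H \<longleftrightarrow> (\<exists>G'. minor_step\<^sup>*\<^sup>* G G' \<and> isomorphic G' H)"

end

theory Submission
  imports Defs
begin

text \<open>
  Suppose that \<open>G\<close> has no total coloring with \<open>k = t - 1\<close> colors, and let \<open>H\<close> be a minimal subgraph of \<open>G\<close>
  with this property, so that \<open>k \<le> \<Delta>(H) + 2\<close>. A vertex \<open>v\<close> of maximum degree and its edges form a clique
  of size \<open>\<Delta>(H) + 1\<close> in \<open>T(H)\<close>. If \<open>k \<ge> \<Delta>(H) + 1\<close>, then \<open>H\<close> has no cut vertex by minimality, and the
  vertices of \<open>H - v\<close> form one further branch set. If \<open>k = \<Delta>(H) + 2\<close>, then recoloring shows that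
  \<open>\<Delta>(H) \<ge> 3\<close> and that all degrees of non-isolated vertices are at least 3, and the vertices and the edges of
  \<open>H - v\<close> give two further branch sets after a small exchange at a neighbor of \<open>v\<close>.

  Connectivity is expressed throughout by the absence of a separating subset, which passes directly to
  contractions and fits the gluing argument for cut vertices.
\<close>

section \<open>Minors from branch sets\<close>

text \<open>Connectivity of the graph that \<open>E\<close> induces on \<open>B\<close>.
  \<open>E\<close> may be any set of sets, so the notion applies equally to a graph, to a subset of
  its edges and to the adjacency of edges. The empty set counts as connected;
  \<open>branch_sets\<close> therefore asks for nonemptiness separately.\<close>

definition connected_in :: "'a set set \<Rightarrow> 'a set \<Rightarrow> bool" where
  "connected_in E B \<longleftrightarrow>
     (\<forall>A. A \<subseteq> B \<longrightarrow> A \<noteq> {} \<longrightarrow> A \<noteq> B \<longrightarrow> (\<exists>x\<in>A. \<exists>y\<in>B - A. {x, y} \<in> E))"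

lemma connected_inD:
  "connected_in E B \<Longrightarrow> A \<subseteq> B \<Longrightarrow> A \<noteq> {} \<Longrightarrow> A \<noteq> B \<Longrightarrow> \<exists>x\<in>A. \<exists>y\<in>B - A. {x, y} \<in> E"
  unfolding connected_in_def by blast

lemma connected_in_singleton: "connected_in E {x}"
  unfolding connected_in_def by blast

text \<open>A separating set either cuts \<open>B\<close> properly, or contains all or nothing of
  \<open>B\<close>; in the latter cases the edge from \<open>x\<close> to \<open>y\<close>
  crosses.\<close>

lemma connected_in_insert:
  assumes B: "connected_in E B" and y: "y \<in> B" "{x, y} \<in> E"
  shows "connected_in E (insert x B)"
  unfolding connected_in_def
proof (intro allI impI)
  fix A assume A: "A \<subseteq> insert x B" "A \<noteq> {}" "A \<noteq> insert x B"
  show "\<exists>u\<in>A. \<exists>w\<in>insert x B - A. {u, w} \<in> E"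
  proof (cases "A \<inter> B \<noteq> {} \<and> A \<inter> B \<noteq> B")
    case True
    then show ?thesis using connected_inD[OF B, of "A \<inter> B"] by blast
  next
    case False
    then consider "A \<inter> B = {}" | "B \<subseteq> A" by blast
    then show ?thesis
    proof cases
      case 1
      then have "x \<in> A" "y \<notin> A" using A y by auto
      then show ?thesis using y by blast
    next
      case 2
      then have "x \<notin> A" "y \<in> A" using A y by auto
      then show ?thesis using y by (metis DiffI insert_commute insertI1)
    qed
  qed
qed

text \<open>Only edges inside \<open>B\<close> matter, so vertices and edges outside
  \<open>B\<close> may be removed.\<close>

lemma connected_in_mono:
  assumes "connected_in E B" and "\<And>e. e \<in> E \<Longrightarrow> e \<subseteq> B \<Longrightarrow> e \<in> E'"
  shows "connected_in E' B"
  unfolding connected_in_def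
proof (intro allI impI)
  fix A assume A: "A \<subseteq> B" "A \<noteq> {}" "A \<noteq> B"
  then obtain x y where "x \<in> A" "y \<in> B - A" "{x, y} \<in> E"
    using connected_inD[OF assms(1)] by blast
  then show "\<exists>x\<in>A. \<exists>y\<in>B - A. {x, y} \<in> E'" using assms(2)[of "{x, y}"] A by blast
qed

text \<open>The preimage of a separating set separates \<open>B\<close>, and the ends of a crossing
  edge have different images. Edges collapsed by \<open>f\<close> are exempt, so that
  \<open>f\<close> may be a contraction as well as an embedding such as \<open>Inl\<close> or
  \<open>Inr\<close>.\<close>

lemma connected_in_image:
  assumes B: "connected_in E B"
    and E: "\<And>x y. x \<in> B \<Longrightarrow> y \<in> B \<Longrightarrow> {x, y} \<in> E \<Longrightarrow> f x \<noteq> f y \<Longrightarrow> {f x, f y} \<in> E'"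
  shows "connected_in E' (f ` B)"
  unfolding connected_in_def
proof (intro allI impI)
  fix A assume A: "A \<subseteq> f ` B" "A \<noteq> {}" "A \<noteq> f ` B"
  have "B \<inter> f -` A \<noteq> {}" "B \<inter> f -` A \<noteq> B" using A by auto
  then obtain x y where "x \<in> B \<inter> f -` A" "y \<in> B - B \<inter> f -` A" "{x, y} \<in> E"
    using connected_inD[OF B, of "B \<inter> f -` A"] by blast
  moreover from this have "{f x, f y} \<in> E'" by (intro E) auto
  ultimately show "\<exists>x\<in>A. \<exists>y\<in>f ` B - A. {x, y} \<in> E'" by blast
qed

text \<open>The line graph of a connected graph is connected. If the edges in \<open>A\<close> cover
  all vertices, every other edge meets one of them; otherwise an edge leading from a covered to an
  uncovered vertex lies outside \<open>A\<close> and meets \<open>A\<close>.\<close>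

lemma connected_in_edges:
  assumes W: "connected_in E W" and E: "\<And>e. e \<in> E \<Longrightarrow> e \<subseteq> W \<and> e \<noteq> {}"
    and E': "\<And>e f. e \<in> E \<Longrightarrow> f \<in> E \<Longrightarrow> e \<noteq> f \<Longrightarrow> e \<inter> f \<noteq> {} \<Longrightarrow> {e, f} \<in> E'"
  shows "connected_in E' E"
  unfolding connected_in_def
proof (intro allI impI)
  fix A assume A: "A \<subseteq> E" "A \<noteq> {}" "A \<noteq> E"
  have "\<exists>e\<in>A. \<exists>f\<in>E - A. e \<inter> f \<noteq> {}"
  proof (cases "\<Union>A = W")
    case True
    obtain f where "f \<in> E - A" using A by blast
    moreover from this obtain z where "z \<in> f" "z \<in> W" using E by blast
    ultimately show ?thesis using True by blast
  next
    case False
    have "\<Union>A \<subseteq> W" "\<Union>A \<noteq> {}" using A E by blast+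
    then obtain x y where xy: "x \<in> \<Union>A" "y \<in> W - \<Union>A" "{x, y} \<in> E"
      using connected_inD[OF W _ _ False] by blast
    then obtain e where e: "e \<in> A" "x \<in> e" by blast
    have "{x, y} \<in> E - A" using xy by blast
    moreover have "e \<inter> {x, y} \<noteq> {}" using e by blast
    ultimately show ?thesis using e(1) by (intro bexI)
  qed
  then obtain e f where "e \<in> A" "f \<in> E - A" "e \<inter> f \<noteq> {}" by blast
  moreover from this have "{e, f} \<in> E'" using A by (intro E') auto
  ultimately show "\<exists>e\<in>A. \<exists>f\<in>E - A. {e, f} \<in> E'" by (intro bexI)
qed

text \<open>A model of a complete minor: contracting every member to a single vertex gives a
  complete graph on \<open>card \<B>\<close> vertices.\<close>

definition branch_sets :: "'a graph \<Rightarrow> 'a set set \<Rightarrow> bool" where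
  "branch_sets G \<B> \<longleftrightarrow>
     (\<forall>B\<in>\<B>. B \<noteq> {} \<and> B \<subseteq> verts G \<and> connected_in (edges G) B) \<and>
     (\<forall>B\<in>\<B>. \<forall>C\<in>\<B>. B \<noteq> C \<longrightarrow> B \<inter> C = {} \<and> (\<exists>x\<in>B. \<exists>y\<in>C. {x, y} \<in> edges G))"

section \<open>Simple graphs and the contraction of edges\<close>

lemma edge_exE:
  assumes "simple_graph G" "e \<in> edges G" "v \<in> e"
  obtains w where "e = {v, w}" "w \<noteq> v" "w \<in> verts G"
proof -
  have e: "card e = 2" "e \<subseteq> verts G" using assms unfolding simple_graph_def by auto
  then obtain x y where "e = {x, y}" "x \<noteq> y" by (meson card_2_iff)
  then show ?thesis using that[of x] that[of y] e assms(3) by auto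
qed

lemma simple_graph_doubleton:
  "simple_graph G \<Longrightarrow> {u, v} \<in> edges G \<Longrightarrow> u \<noteq> v \<and> u \<in> verts G \<and> v \<in> verts G"
  unfolding simple_graph_def by fastforce

lemma simple_graph_finite_edges: "simple_graph G \<Longrightarrow> finite (edges G)"
  unfolding simple_graph_def by (meson PowI finite_Pow_iff finite_subset subsetI)

lemma simple_graph_delete_vertex: "simple_graph G \<Longrightarrow> simple_graph (delete_vertex G v)"
  unfolding simple_graph_def delete_vertex_def by auto

lemma simple_graph_contract_edge:
  assumes G: "simple_graph G" and uv: "{u, v} \<in> edges G"
  shows "simple_graph (contract_edge G u v)"
proof -
  note d = simple_graph_doubleton[OF G uv]
  have "id(v := u) ` e \<subseteq> verts G - {v} \<and> card (id(v := u) ` e) = 2"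
    if e: "e \<in> edges G" "e \<noteq> {u, v}" for e
  proof -
    have "card e = 2" "e \<subseteq> verts G" using G e unfolding simple_graph_def by auto
    then obtain x y where xy: "e = {x, y}" "x \<noteq> y" by (meson card_2_iff)
    have "x \<in> verts G" "y \<in> verts G" using xy \<open>e \<subseteq> verts G\<close> by auto
    \<comment> \<open>The map identifies no vertices other than \<open>u\<close> and
      \<open>v\<close>, so no edge but \<open>{u, v}\<close> itself becomes a loop.\<close>
    moreover have "(id(v := u)) x \<noteq> (id(v := u)) y" using xy e by (auto split: if_splits)
    ultimately show ?thesis
      using d unfolding xy(1) image_insert image_empty by (auto simp: card_2_iff)
  qed
  then show ?thesis using G unfolding simple_graph_def contract_edge_def by auto
qed

lemma has_minor_step: "minor_step G G' \<Longrightarrow> has_minor G' H \<Longrightarrow> has_minor G H"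
  unfolding has_minor_def by (meson converse_rtranclp_into_rtranclp)

text \<open>By disjointness, \<open>u\<close> and \<open>v\<close> lie in no member other than
  \<open>B\<^sub>0\<close>, so all other members are left unchanged. The images stay disjoint and
  nonempty, hence distinct, which preserves the cardinality.\<close>

lemma branch_sets_contract_edge:
  assumes G: "simple_graph G" and \<B>: "branch_sets G \<B>"
    and uv: "{u, v} \<in> edges G" "u \<in> B\<^sub>0" "v \<in> B\<^sub>0" "B\<^sub>0 \<in> \<B>"
  shows "branch_sets (contract_edge G u v) ((`) (id(v := u)) ` \<B>)"
    and "card ((`) (id(v := u)) ` \<B>) = card \<B>"
proof -
  let ?f = "id(v := u)" and ?H = "contract_edge G u v"
  have d: "u \<noteq> v" "u \<in> verts G" using simple_graph_doubleton[OF G uv(1)] by auto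
  have E: "{?f x, ?f y} \<in> edges ?H" if "{x, y} \<in> edges G" "?f x \<noteq> ?f y" for x y
  proof -
    have "{x, y} \<noteq> {u, v}"
    proof
      assume "{x, y} = {u, v}"
      then have "?f x = u" "?f y = u" by (auto simp: doubleton_eq_iff)
      then show False using that by simp
    qed
    then have "?f ` {x, y} \<in> edges ?H" using that unfolding contract_edge_def by auto
    then show ?thesis by (simp only: image_insert image_empty)
  qed
  have u0: "B = B\<^sub>0" if "B \<in> \<B>" "u \<in> B \<or> v \<in> B" for B
    using \<B> uv that unfolding branch_sets_def by blast
  have disj: "?f ` B \<inter> ?f ` C = {}" if "B \<in> \<B>" "C \<in> \<B>" "B \<noteq> C" for B C
  proof -
    have "B \<inter> C = {}" using \<B> that unfolding branch_sets_def by blast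
    then show ?thesis using u0[OF that(1)] u0[OF that(2)] that(3) by (auto split: if_splits)
  qed
  have B: "B \<noteq> {} \<and> B \<subseteq> verts G \<and> connected_in (edges G) B" if "B \<in> \<B>" for B
    using \<B> that unfolding branch_sets_def by blast
  show "branch_sets ?H ((`) ?f ` \<B>)"
    unfolding branch_sets_def
  proof (intro conjI ballI impI)
    fix X assume "X \<in> (`) ?f ` \<B>"
    then obtain B where X: "X = ?f ` B" "B \<in> \<B>" by blast
    note B = B[OF X(2)]
    show "X \<noteq> {}" using B unfolding X(1) image_is_empty by blast
    show "X \<subseteq> verts ?H" using B X d unfolding contract_edge_def by auto
    show "connected_in (edges ?H) X"
      unfolding X(1) using B by (intro connected_in_image[of "edges G"] E) auto
  next
    fix X Y assume "X \<in> (`) ?f ` \<B>" "Y \<in> (`) ?f ` \<B>" "X \<noteq> Y"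
    then obtain B C where BC: "X = ?f ` B" "B \<in> \<B>" "Y = ?f ` C" "C \<in> \<B>" "B \<noteq> C" by blast
    then show 1: "X \<inter> Y = {}" using disj by blast
    obtain x y where xy: "x \<in> B" "y \<in> C" "{x, y} \<in> edges G"
      using \<B> BC unfolding branch_sets_def by meson
    then have "?f x \<in> X" "?f y \<in> Y" using BC by auto
    moreover from this have "{?f x, ?f y} \<in> edges ?H" using 1 xy by (intro E) auto
    ultimately show "\<exists>x\<in>X. \<exists>y\<in>Y. {x, y} \<in> edges ?H" by blast
  qed
  have "inj_on ((`) ?f) \<B>"
  proof (rule inj_onI, rule ccontr)
    fix B C assume *: "B \<in> \<B>" "C \<in> \<B>" "?f ` B = ?f ` C" "B \<noteq> C"
    then have "?f ` B = {}" using disj by blast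
    then show False using B[OF *(1)] unfolding image_is_empty by blast
  qed
  then show "card ((`) ?f ` \<B>) = card \<B>" by (rule card_image)
qed

text \<open>Induction on the number of vertices. A vertex outside all branch sets is deleted; if
  there is none, an edge inside a branch set with at least two vertices is contracted. When neither
  applies, the branch sets are exactly the singletons of vertices, so \<open>G\<close> itself is
  complete.\<close>

lemma has_minor_complete_graph:
  assumes "simple_graph G" "branch_sets G \<B>" "card \<B> = t"
  shows "has_minor G (complete_graph t)"
  using assms
proof (induction "card (verts G)" arbitrary: G \<B> rule: less_induct)
  case less
  note G = less.prems(1) and \<B> = less.prems(2)
  have fin: "finite (verts G)" using G unfolding simple_graph_def by blast
  have sub: "\<Union>\<B> \<subseteq> verts G" using \<B> unfolding branch_sets_def by blast
  show ?case
  proof (cases "\<Union>\<B> = verts G")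
    case False
    then obtain v where v: "v \<in> verts G" "v \<notin> \<Union>\<B>" using sub by blast
    let ?H = "delete_vertex G v"
    have "branch_sets ?H \<B>"
      unfolding branch_sets_def
    proof (intro conjI ballI impI)
      fix B assume "B \<in> \<B>"
      then have B: "B \<noteq> {}" "B \<subseteq> verts G" "connected_in (edges G) B" "v \<notin> B"
        using \<B> v unfolding branch_sets_def by auto
      then show "B \<noteq> {}" "B \<subseteq> verts ?H" "connected_in (edges ?H) B"
        by (auto simp: delete_vertex_def intro: connected_in_mono[of "edges G"])
    next
      fix B C assume BC: "B \<in> \<B>" "C \<in> \<B>" "B \<noteq> C"
      then show "B \<inter> C = {}" using \<B> unfolding branch_sets_def by blast
      obtain x y where "x \<in> B" "y \<in> C" "{x, y} \<in> edges G"
        using \<B> BC unfolding branch_sets_def by meson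
      then show "\<exists>x\<in>B. \<exists>y\<in>C. {x, y} \<in> edges ?H"
        using v BC unfolding delete_vertex_def by auto
    qed
    moreover have "card (verts ?H) < card (verts G)"
      unfolding delete_vertex_def using card_Diff1_less[OF fin v(1)] by simp
    ultimately have "has_minor ?H (complete_graph t)"
      using less.hyps[OF _ simple_graph_delete_vertex[OF G]] less.prems(3) by blast
    then show ?thesis using has_minor_step[OF del_vertex[OF v(1)]] by blast
  next
    case V: True
    show ?thesis
    proof (cases "\<exists>B\<in>\<B>. \<exists>u\<in>B. B \<noteq> {u}")
      case True
      then obtain B u where B: "B \<in> \<B>" "u \<in> B" "{u} \<noteq> B" by blast
      then obtain v where v: "v \<in> B" "{u, v} \<in> edges G"
        using \<B> connected_inD[of "edges G" B "{u}"] unfolding branch_sets_def by auto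
      have vV: "v \<in> verts G" using simple_graph_doubleton[OF G v(2)] by blast
      have "card (verts (contract_edge G u v)) < card (verts G)"
        unfolding contract_edge_def using card_Diff1_less[OF fin vV] by simp
      then have "has_minor (contract_edge G u v) (complete_graph t)"
        using less.hyps[OF _ simple_graph_contract_edge[OF G v(2)]]
          branch_sets_contract_edge[OF G \<B> v(2) B(2) v(1) B(1)] less.prems(3) by metis
      then show ?thesis using has_minor_step[OF contract[OF v(2)]] by blast
    next
      case False
      then have sing: "B = {u}" if "B \<in> \<B>" "u \<in> B" for B u using that by blast
      have \<B>eq: "\<B> = (\<lambda>x. {x}) ` verts G"
      proof
        show "\<B> \<subseteq> (\<lambda>x. {x}) ` verts G"
        proof
          fix B assume B: "B \<in> \<B>"
          then obtain u where "u \<in> B" using \<B> unfolding branch_sets_def by blast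
          then show "B \<in> (\<lambda>x. {x}) ` verts G" using sing[OF B] sub B by blast
        qed
        show "(\<lambda>x. {x}) ` verts G \<subseteq> \<B>" using sing V by fastforce
      qed
      have "card (verts G) = t"
        using less.prems(3) card_image[of "\<lambda>x. {x}" "verts G"] \<B>eq by auto
      then obtain f where f: "bij_betw f (verts G) {..<t}"
        using fin by (metis card_lessThan finite_lessThan finite_same_card_bij)
      have "{u, v} \<in> edges G \<longleftrightarrow> {f u, f v} \<in> edges (complete_graph t)"
        if "u \<in> verts G" "v \<in> verts G" for u v
      proof -
        have "{u, v} \<in> edges G \<longleftrightarrow> u \<noteq> v"
        proof
          assume "{u, v} \<in> edges G"
          then show "u \<noteq> v" using simple_graph_doubleton[OF G] by blast
        next
          assume "u \<noteq> v"
          moreover have "{u} \<in> \<B>" "{v} \<in> \<B>" using \<B>eq that by auto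
          ultimately have "\<exists>x\<in>{u}. \<exists>y\<in>{v}. {x, y} \<in> edges G"
            using \<B> unfolding branch_sets_def by (metis singleton_inject)
          then show "{u, v} \<in> edges G" by simp
        qed
        also have "\<dots> \<longleftrightarrow> f u \<noteq> f v"
          using f that by (auto simp: bij_betw_def inj_on_eq_iff)
        also have "\<dots> \<longleftrightarrow> {f u, f v} \<in> edges (complete_graph t)"
          using f that by (auto simp: complete_graph_def bij_betw_def card_2_iff doubleton_eq_iff)
        finally show ?thesis .
      qed
      then have "isomorphic G (complete_graph t)"
        using f unfolding isomorphic_def complete_graph_def by auto
      then show ?thesis unfolding has_minor_def by blast
    qed
  qed
qed

lemma branch_sets_subset: "branch_sets G \<B> \<Longrightarrow> \<C> \<subseteq> \<B> \<Longrightarrow> branch_sets G \<C>"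
  unfolding branch_sets_def by (simp add: subset_eq[of \<C>])

lemma branch_sets_mono:
  assumes "branch_sets H \<B>" "verts H \<subseteq> verts G" "edges H \<subseteq> edges G"
  shows "branch_sets G \<B>"
  unfolding branch_sets_def
proof (intro conjI ballI impI)
  fix B assume "B \<in> \<B>"
  then have "B \<noteq> {}" "B \<subseteq> verts H" "connected_in (edges H) B"
    using assms(1) unfolding branch_sets_def by auto
  then show "B \<noteq> {}" "B \<subseteq> verts G" "connected_in (edges G) B"
    using assms(2,3) connected_in_mono[of "edges H" B "edges G"] by auto
next
  fix B C assume BC: "B \<in> \<B>" "C \<in> \<B>" "B \<noteq> C"
  then show "B \<inter> C = {}" using assms(1) unfolding branch_sets_def by blast
  show "\<exists>x\<in>B. \<exists>y\<in>C. {x, y} \<in> edges G"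
    using BC assms(1,3) unfolding branch_sets_def by (meson subsetD)
qed

lemma branch_sets_insert:
  assumes "branch_sets G \<B>" "B \<noteq> {}" "B \<subseteq> verts G" "connected_in (edges G) B"
    and "\<And>C. C \<in> \<B> \<Longrightarrow> B \<inter> C = {} \<and> (\<exists>x\<in>B. \<exists>y\<in>C. {x, y} \<in> edges G)"
  shows "branch_sets G (insert B \<B>)"
proof -
  have "C \<inter> B = {} \<and> (\<exists>x\<in>C. \<exists>y\<in>B. {x, y} \<in> edges G)" if "C \<in> \<B>" for C
    using assms(5)[OF that] by (metis Int_commute insert_commute)
  then show ?thesis
    using assms unfolding branch_sets_def by (simp add: Ball_def)
qed

section \<open>Total graphs\<close>

lemma total_graph_simps:
  "verts (total_graph G) = verts G <+> edges G"
  "{u, w} \<in> edges G \<Longrightarrow> {Inl u, Inl w} \<in> edges (total_graph G)"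
  "e \<in> edges G \<Longrightarrow> f \<in> edges G \<Longrightarrow> e \<noteq> f \<Longrightarrow> e \<inter> f \<noteq> {} \<Longrightarrow> {Inr e, Inr f} \<in> edges (total_graph G)"
  "e \<in> edges G \<Longrightarrow> v \<in> e \<Longrightarrow> {Inl v, Inr e} \<in> edges (total_graph G)"
  "e \<in> edges G \<Longrightarrow> v \<in> e \<Longrightarrow> {Inr e, Inl v} \<in> edges (total_graph G)"
proof -
  show E: "e \<in> edges G \<Longrightarrow> v \<in> e \<Longrightarrow> {Inl v, Inr e} \<in> edges (total_graph G)"
    and "{u, w} \<in> edges G \<Longrightarrow> {Inl u, Inl w} \<in> edges (total_graph G)"
    and "e \<in> edges G \<Longrightarrow> f \<in> edges G \<Longrightarrow> e \<noteq> f \<Longrightarrow> e \<inter> f \<noteq> {} \<Longrightarrow>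
      {Inr e, Inr f} \<in> edges (total_graph G)"
    unfolding total_graph_def graph.sel by blast+
  show "e \<in> edges G \<Longrightarrow> v \<in> e \<Longrightarrow> {Inr e, Inl v} \<in> edges (total_graph G)"
    using E by (simp add: insert_commute)
qed (simp add: total_graph_def)

lemma total_graph_edgeE:
  assumes "x \<in> edges (total_graph G)"
  obtains u w where "x = {Inl u, Inl w}" "{u, w} \<in> edges G"
  | e f where "x = {Inr e, Inr f}" "e \<in> edges G" "f \<in> edges G" "e \<noteq> f" "e \<inter> f \<noteq> {}"
  | v e where "x = {Inl v, Inr e}" "e \<in> edges G" "v \<in> e"
  using assms unfolding total_graph_def graph.sel by blast

lemma simple_graph_total_graph:
  assumes "simple_graph G"
  shows "simple_graph (total_graph G)"
proof -
  have "finite (verts (total_graph G))"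
    using assms simple_graph_finite_edges unfolding simple_graph_def total_graph_simps by auto
  moreover have "e \<subseteq> verts (total_graph G) \<and> card e = 2" if "e \<in> edges (total_graph G)" for e
    using that
  proof (cases rule: total_graph_edgeE)
    case (1 u w)
    then show ?thesis
      using simple_graph_doubleton[OF assms 1(2)] by (auto simp: total_graph_simps)
  next
    case (2 e f)
    then show ?thesis by (auto simp: total_graph_simps)
  next
    case (3 v e)
    then show ?thesis
      using assms unfolding simple_graph_def by (auto simp: total_graph_simps)
  qed
  ultimately show ?thesis unfolding simple_graph_def by blast
qed

text \<open>This carries branch sets from the total graph of a critical subgraph over to that of the
  whole graph.\<close>

lemma total_graph_mono:
  assumes "subgraph H G"
  shows "verts (total_graph H) \<subseteq> verts (total_graph G)"
    and "edges (total_graph H) \<subseteq> edges (total_graph G)"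
proof -
  have H: "verts H \<subseteq> verts G" "edges H \<subseteq> edges G" using assms unfolding subgraph_def by auto
  then show "verts (total_graph H) \<subseteq> verts (total_graph G)"
    unfolding total_graph_simps by blast
  show "edges (total_graph H) \<subseteq> edges (total_graph G)"
  proof
    fix x assume "x \<in> edges (total_graph H)"
    then show "x \<in> edges (total_graph G)"
      by (cases rule: total_graph_edgeE) (use H in \<open>auto intro!: total_graph_simps\<close>)
  qed
qed

section \<open>Total colorings and the number of their colors\<close>

lemma total_coloringI:
  assumes "\<And>u v. u \<in> verts G \<Longrightarrow> v \<in> verts G \<Longrightarrow> {u, v} \<in> edges G \<Longrightarrow> c (Inl u) \<noteq> c (Inl v)"
    and "\<And>e f. e \<in> edges G \<Longrightarrow> f \<in> edges G \<Longrightarrow> e \<noteq> f \<Longrightarrow> e \<inter> f \<noteq> {} \<Longrightarrow> c (Inr e) \<noteq> c (Inr f)"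
    and "\<And>e v. e \<in> edges G \<Longrightarrow> v \<in> e \<Longrightarrow> c (Inl v) \<noteq> c (Inr e)"
  shows "total_coloring G c"
  using assms unfolding total_coloring_def by simp

lemma total_coloringD:
  assumes "total_coloring G c"
  shows "u \<in> verts G \<Longrightarrow> v \<in> verts G \<Longrightarrow> {u, v} \<in> edges G \<Longrightarrow> c (Inl u) \<noteq> c (Inl v)"
    and "e \<in> edges G \<Longrightarrow> f \<in> edges G \<Longrightarrow> e \<noteq> f \<Longrightarrow> e \<inter> f \<noteq> {} \<Longrightarrow> c (Inr e) \<noteq> c (Inr f)"
    and "e \<in> edges G \<Longrightarrow> v \<in> e \<Longrightarrow> c (Inl v) \<noteq> c (Inr e)"
  using assms unfolding total_coloring_def by simp_all

text \<open>The predicate under \<open>LEAST\<close> in \<open>total_chromatic_number\<close>, named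
  because it is monotone in \<open>k\<close> and can be negated directly.\<close>

definition total_colorable :: "'a graph \<Rightarrow> nat \<Rightarrow> bool" where
  "total_colorable G k \<longleftrightarrow>
     (\<exists>c. total_coloring G c \<and> c ` (verts G <+> edges G) \<subseteq> {..<k})"

lemma total_colorable_mono: "total_colorable G k \<Longrightarrow> k \<le> l \<Longrightarrow> total_colorable G l"
  unfolding total_colorable_def by (meson lessThan_subset_iff subset_trans)

text \<open>\<open>LEAST\<close> is meaningful only if some number of colors suffices; giving all
  vertices and edges different colors provides one.\<close>

lemma total_colorable_total_chromatic_number:
  assumes "simple_graph G"
  shows "total_colorable G (total_chromatic_number G)"
proof -
  have "finite (verts G <+> edges G)"
    using assms simple_graph_finite_edges unfolding simple_graph_def by auto
  then obtain c :: "'a + 'a set \<Rightarrow> nat" and n where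
    c: "c ` (verts G <+> edges G) = {i. i < n}" "inj_on c (verts G <+> edges G)"
    using finite_imp_inj_to_nat_seg[of "verts G <+> edges G"] by blast
  have "total_coloring G c"
  proof (rule total_coloringI)
    fix u v assume "u \<in> verts G" "v \<in> verts G" "{u, v} \<in> edges G"
    then show "c (Inl u) \<noteq> c (Inl v)"
      using inj_onD[OF c(2)] simple_graph_doubleton[OF assms] by blast
  next
    fix e f assume "e \<in> edges G" "f \<in> edges G" "e \<noteq> f"
    then show "c (Inr e) \<noteq> c (Inr f)" using inj_onD[OF c(2)] by blast
  next
    fix e v assume "e \<in> edges G" "v \<in> e"
    then show "c (Inl v) \<noteq> c (Inr e)"
      using inj_onD[OF c(2), of "Inl v" "Inr e"] assms unfolding simple_graph_def by blast
  qed
  then have "total_colorable G n" using c unfolding total_colorable_def by auto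
  then show ?thesis
    unfolding total_colorable_def total_chromatic_number_def by (rule LeastI)
qed

text \<open>A total coloring of \<open>G\<close> is a proper coloring of its total graph.\<close>

lemma chromatic_number_total_graph_le:
  assumes "simple_graph G" "total_colorable G k"
  shows "chromatic_number (total_graph G) \<le> k"
proof -
  obtain c where c: "total_coloring G c" "c ` (verts G <+> edges G) \<subseteq> {..<k}"
    using assms(2) unfolding total_colorable_def by blast
  have "proper_coloring (total_graph G) c"
    unfolding proper_coloring_def
  proof (intro ballI impI)
    fix x y assume "{x, y} \<in> edges (total_graph G)"
    then show "c x \<noteq> c y"
    proof (cases rule: total_graph_edgeE)
      case (1 u v)
      then have "c (Inl u) \<noteq> c (Inl v)"
        using simple_graph_doubleton[OF assms(1)] by (intro total_coloringD[OF c(1)]) auto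
      then show ?thesis using 1(1) by (auto simp: doubleton_eq_iff)
    next
      case (2 e f)
      then have "c (Inr e) \<noteq> c (Inr f)" by (intro total_coloringD[OF c(1)])
      then show ?thesis using 2(1) by (auto simp: doubleton_eq_iff)
    next
      case (3 v e)
      then have "c (Inl v) \<noteq> c (Inr e)" by (intro total_coloringD[OF c(1)])
      then show ?thesis using 3(1) by (auto simp: doubleton_eq_iff)
    qed
  qed
  then show ?thesis
    unfolding chromatic_number_def using c(2) by (intro Least_le) (auto simp: total_graph_def)
qed

section \<open>Critical graphs\<close>

lemma degree_le_max_degree:
  assumes "simple_graph G" "v \<in> verts G"
  shows "degree G v \<le> max_degree G"
  using assms unfolding max_degree_def simple_graph_def by (intro Max_ge) auto

lemma max_degree_attained:
  assumes "simple_graph G" "verts G \<noteq> {}"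
  obtains v where "v \<in> verts G" "degree G v = max_degree G"
proof -
  have fin: "finite (verts G)" using assms unfolding simple_graph_def by blast
  have "max_degree G \<in> insert 0 (degree G ` verts G)"
    unfolding max_degree_def by (rule Max_in) (use fin in auto)
  then consider "max_degree G \<in> degree G ` verts G" | "max_degree G = 0" by (elim insertE)
  then show ?thesis
  proof cases
    case 1
    then show ?thesis using that by auto
  next
    \<comment> \<open>The maximum may come from the inserted 0; then every vertex has degree
      0.\<close>
    case 2
    obtain v where v: "v \<in> verts G" using assms(2) by blast
    then show ?thesis using that[OF v] degree_le_max_degree[OF assms(1) v] 2 by simp
  qed
qed

lemma neighbours_card_le:
  assumes "simple_graph G"
  shows "finite {x. {u, x} \<in> edges G}" "card {x. {u, x} \<in> edges G} \<le> degree G u"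
proof -
  have "{x. {u, x} \<in> edges G} \<subseteq> verts G" using simple_graph_doubleton[OF assms] by blast
  then show "finite {x. {u, x} \<in> edges G}"
    using assms finite_subset unfolding simple_graph_def by blast
  have "inj_on (\<lambda>x. {u, x}) {x. {u, x} \<in> edges G}"
    by (auto intro!: inj_onI simp: doubleton_eq_iff)
  then show "card {x. {u, x} \<in> edges G} \<le> degree G u"
    unfolding degree_def using simple_graph_finite_edges[OF assms] by (intro card_inj_on_le) auto
qed

lemma edge_outside:
  assumes "finite X" "card X < degree G u"
  obtains g where "g \<in> edges G" "u \<in> g" "g \<notin> X"
proof -
  have "\<not> {e \<in> edges G. u \<in> e} \<subseteq> X"
    using card_mono[OF assms(1), of "{e \<in> edges G. u \<in> e}"] assms(2) unfolding degree_def by linarith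
  then show ?thesis using that by blast
qed

lemma free_color:
  assumes "finite X" "card X < k"
  obtains a :: nat where "a < k" "a \<notin> X"
proof -
  have "\<not> {..<k} \<subseteq> X" using assms card_mono[OF assms(1), of "{..<k}"] by auto
  then show ?thesis using that by auto
qed

text \<open>Minimality concerns the deletion of vertices as well as of edges, and both are used to
  obtain colorings of smaller graphs.\<close>

definition critical :: "'a graph \<Rightarrow> nat \<Rightarrow> bool" where
  "critical G k \<longleftrightarrow> simple_graph G \<and> \<not> total_colorable G k \<and>
     (\<forall>H. subgraph H G \<longrightarrow> H \<noteq> G \<longrightarrow> total_colorable H k)"

text \<open>A proper subgraph has fewer vertices or fewer edges, so the descent ends by induction on
  the sum of the two numbers.\<close>

lemma critical_subgraph:
  assumes "simple_graph G" "\<not> total_colorable G k"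
  obtains H where "subgraph H G" "critical H k"
proof -
  have "\<exists>H. subgraph H G \<and> critical H k"
    using assms
  proof (induction "card (verts G) + card (edges G)" arbitrary: G rule: less_induct)
    case less
    note G = less.prems(1)
    show ?case
    proof (cases "critical G k")
      case True
      then show ?thesis using G unfolding subgraph_def by blast
    next
      case False
      then obtain H where H: "subgraph H G" "H \<noteq> G" "\<not> total_colorable H k"
        using less.prems unfolding critical_def by blast
      have sub: "simple_graph H" "verts H \<subseteq> verts G" "edges H \<subseteq> edges G"
        using H(1) unfolding subgraph_def by auto
      have fin: "finite (verts G)" "finite (edges G)"
        using G simple_graph_finite_edges unfolding simple_graph_def by auto
      have "verts H \<subset> verts G \<or> edges H \<subset> edges G"
        using H(2) sub by (metis graph.expand psubsetI)
      then have "card (verts H) + card (edges H) < card (verts G) + card (edges G)"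
        using psubset_card_mono[OF fin(1), of "verts H"] psubset_card_mono[OF fin(2), of "edges H"]
          card_mono[OF fin(1) sub(2)] card_mono[OF fin(2) sub(3)] by linarith
      then obtain K where "subgraph K H" "critical K k" using less.hyps H sub by blast
      then show ?thesis using H(1) unfolding subgraph_def by (meson subset_trans)
    qed
  qed
  then show ?thesis using that by blast
qed

lemma critical_edges_nonempty:
  assumes "critical G k" "k > 0"
  shows "edges G \<noteq> {}"
proof
  assume "edges G = {}"
  then have "total_coloring G (\<lambda>_. 0)" by (intro total_coloringI) auto
  then have "total_colorable G k" unfolding total_colorable_def using assms(2) by auto
  then show False using assms(1) unfolding critical_def by blast
qed

lemma critical_verts_nonempty:
  assumes "critical G k"
  shows "verts G \<noteq> {}"
proof
  assume V: "verts G = {}"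
  have "simple_graph G" using assms unfolding critical_def by blast
  then have "edges G = {}" using V unfolding simple_graph_def by fastforce
  then have "total_coloring G (\<lambda>_. 0)" "verts G <+> edges G = {}"
    using V by (auto intro!: total_coloringI)
  then have "total_colorable G k" unfolding total_colorable_def by blast
  then show False using assms unfolding critical_def by blast
qed

text \<open>In the application, \<open>a\<close> and \<open>b\<close> are the colors of a cut vertex
  on its two sides, and \<open>P\<close> and \<open>Q\<close> are the colors of its edges there. The
  bound on the cardinalities leaves room in \<open>K - insert a P\<close> for a set \<open>R\<close>
  of size \<open>card Q\<close>. Send \<open>b\<close> to \<open>a\<close>, \<open>Q\<close> onto
  \<open>R\<close>, and the rest of \<open>K\<close> onto the rest.\<close>

lemma permute_avoiding:
  assumes K: "finite K" "insert a P \<subseteq> K" "insert b Q \<subseteq> K" "a \<notin> P" "b \<notin> Q"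
    and card: "card P + card Q < card K"
  obtains \<pi> where "inj_on \<pi> K" "\<pi> ` K \<subseteq> K" "\<pi> b = a" "\<pi> ` Q \<inter> P = {}"
proof -
  have fin: "finite P" "finite Q" using K finite_subset by auto
  have "card (K - insert a P) = card K - Suc (card P)"
    using K fin by (subst card_Diff_subset) auto
  then have "card Q \<le> card (K - insert a P)" using card by linarith
  then obtain R where R: "R \<subseteq> K - insert a P" "card R = card Q" "finite R"
    by (rule obtain_subset_with_card_n)
  obtain g where g: "bij_betw g Q R"
    using fin R by (metis finite_same_card_bij)
  have "card (K - insert b Q) = card K - Suc (card Q)"
    using K fin by (subst card_Diff_subset) auto
  moreover have "a \<notin> R" using R by blast
  then have "card (K - insert a R) = card K - Suc (card R)"
    using K R by (subst card_Diff_subset) auto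
  ultimately obtain h where h: "bij_betw h (K - insert b Q) (K - insert a R)"
    using K(1) R by (metis finite_Diff finite_same_card_bij)
  define \<pi> where "\<pi> x = (if x = b then a else if x \<in> Q then g x else h x)" for x
  have "bij_betw \<pi> Q R"
    using g K(5) by (subst bij_betw_cong[of _ _ g]) (auto simp: \<pi>_def)
  moreover have "bij_betw \<pi> (K - insert b Q) (K - insert a R)"
    using h by (subst bij_betw_cong[of _ _ h]) (auto simp: \<pi>_def)
  ultimately have "bij_betw \<pi> (Q \<union> (K - insert b Q)) (R \<union> (K - insert a R))"
    by (rule bij_betw_combine) blast
  moreover have "bij_betw \<pi> {b} {a}" by (simp add: \<pi>_def bij_betw_def)
  ultimately have "bij_betw \<pi> (Q \<union> (K - insert b Q) \<union> {b}) (R \<union> (K - insert a R) \<union> {a})"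
    by (rule bij_betw_combine) (use R in blast)
  moreover have "Q \<union> (K - insert b Q) \<union> {b} = K" "R \<union> (K - insert a R) \<union> {a} = K"
    using K R by auto
  ultimately have \<pi>: "bij_betw \<pi> K K" by simp
  have "\<pi> ` Q = R" using \<open>bij_betw \<pi> Q R\<close> unfolding bij_betw_def by blast
  then have "\<pi> ` Q \<inter> P = {}" using R by blast
  moreover have "\<pi> b = a" by (simp add: \<pi>_def)
  ultimately show ?thesis using that[of \<pi>] \<pi> unfolding bij_betw_def by blast
qed

text \<open>Otherwise the two sides can be colored separately, and the colors of one side permuted so that
  the colorings agree at \<open>v\<close> and use disjoint sets of colors on the edges at \<open>v\<close>.\<close>

lemma critical_no_cut_vertex:
  assumes H: "critical H k" and k: "max_degree H < k" and v: "v \<in> verts H"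
  shows "connected_in (edges H) (verts H - {v})"
proof (rule ccontr)
  assume "\<not> ?thesis"
  then obtain A where A: "A \<subseteq> verts H - {v}" "A \<noteq> {}" "A \<noteq> verts H - {v}"
    "\<And>x y. x \<in> A \<Longrightarrow> y \<in> verts H - {v} - A \<Longrightarrow> {x, y} \<notin> edges H"
    unfolding connected_in_def by blast
  define B where "B = verts H - {v} - A"
  have AB: "v \<notin> A" "v \<notin> B" "A \<inter> B = {}" "B \<noteq> {}" "verts H = insert v (A \<union> B)"
    using A(1-3) v unfolding B_def by auto
  have simple: "simple_graph H" using H unfolding critical_def by blast
  \<comment> \<open>Each side together with the cut vertex \<open>v\<close> induces a proper
    subgraph, which is colorable by criticality.\<close>
  define part where "part X = Graph (insert v X) {e \<in> edges H. e \<subseteq> insert v X}" for X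
  have part: "verts (part X) = insert v X" "edges (part X) = {e \<in> edges H. e \<subseteq> insert v X}" for X
    unfolding part_def by auto
  have col: "total_colorable (part X) k" if "X = A \<or> X = B" for X
  proof -
    have "subgraph (part X) H" using simple that AB(5) finite_subset[of "insert v X" "verts H"]
      unfolding subgraph_def simple_graph_def part by auto
    moreover have "part X \<noteq> H" using AB A(2) that part(1)[of X] by auto
    ultimately show ?thesis using H unfolding critical_def by blast
  qed
  obtain c1 where c1: "total_coloring (part A) c1"
      "c1 ` (verts (part A) <+> edges (part A)) \<subseteq> {..<k}"
    using col[of A] unfolding total_colorable_def by blast
  obtain c2 where c2: "total_coloring (part B) c2"
      "c2 ` (verts (part B) <+> edges (part B)) \<subseteq> {..<k}"
    using col[of B] unfolding total_colorable_def by blast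
  have range1: "c1 (Inl x) < k" if "x \<in> insert v A" for x using c1(2) that part(1)[of A] by auto
  have range1': "c1 (Inr e) < k" if "e \<in> edges (part A)" for e using c1(2) that by auto
  have range2: "c2 (Inl x) < k" if "x \<in> insert v B" for x using c2(2) that part(1)[of B] by auto
  have range2': "c2 (Inr e) < k" if "e \<in> edges (part B)" for e using c2(2) that by auto
  have split: "e \<in> edges (part A) \<or> e \<in> edges (part B)" if "e \<in> edges H" for e
  proof -
    have "card e = 2" "e \<subseteq> verts H" using simple that unfolding simple_graph_def by auto
    then obtain x y where xy: "e = {x, y}" "x \<in> verts H" "y \<in> verts H"
      unfolding card_2_iff by auto
    have "\<not> (x \<in> A \<and> y \<in> B)" "\<not> (y \<in> A \<and> x \<in> B)"
      using A(4)[of x y] A(4)[of y x] that unfolding xy(1) B_def by (auto simp: insert_commute)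
    then show ?thesis using that xy AB(5) unfolding part by auto
  qed
  have disj: False if "e \<in> edges (part A)" "e \<in> edges (part B)" for e
  proof -
    have "e \<subseteq> {v}" using that AB(3) unfolding part by blast
    moreover have "card e = 2" using that simple unfolding part simple_graph_def by blast
    ultimately show False using card_mono[of "{v}" e] by simp
  qed
  \<comment> \<open>The edges at \<open>v\<close> split between the two parts, so \<open>P1\<close>
    and \<open>P2\<close> have together at most \<open>degree H v\<close> elements. This is less
    than \<open>k\<close>, as the permutation of colors demands.\<close>
  define D1 D2 where "D1 = {e \<in> edges (part A). v \<in> e}" and "D2 = {e \<in> edges (part B). v \<in> e}"
  define P1 P2 where "P1 = (\<lambda>e. c1 (Inr e)) ` D1" and "P2 = (\<lambda>e. c2 (Inr e)) ` D2"
  have finD: "finite D1" "finite D2"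
    using simple_graph_finite_edges[OF simple] unfolding D1_def D2_def part by auto
  have "D1 \<union> D2 = {e \<in> edges H. v \<in> e}"
    using split unfolding D1_def D2_def part by blast
  moreover have "D1 \<inter> D2 = {}" using disj unfolding D1_def D2_def by blast
  ultimately have "card D1 + card D2 = degree H v"
    unfolding degree_def using card_Un_disjoint[OF finD] by simp
  then have "card P1 + card P2 < card {..<k}"
    using card_image_le[OF finD(1)] card_image_le[OF finD(2)] k
      degree_le_max_degree[OF simple v] unfolding P1_def P2_def
    by (metis (no_types, lifting) add_mono card_lessThan le_trans order_le_less_trans)
  moreover have "c1 (Inl v) \<notin> P1" "c2 (Inl v) \<notin> P2"
    using total_coloringD(3)[OF c1(1)] total_coloringD(3)[OF c2(1)]
    unfolding P1_def P2_def D1_def D2_def by auto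
  moreover have "insert (c1 (Inl v)) P1 \<subseteq> {..<k}" "insert (c2 (Inl v)) P2 \<subseteq> {..<k}"
    using range1 range1' range2 range2' unfolding P1_def P2_def D1_def D2_def by auto
  ultimately obtain \<pi> where \<pi>: "inj_on \<pi> {..<k}" "\<pi> ` {..<k} \<subseteq> {..<k}"
      "\<pi> (c2 (Inl v)) = c1 (Inl v)" "\<pi> ` P2 \<inter> P1 = {}"
    using permute_avoiding[of "{..<k}" "c1 (Inl v)" P1 "c2 (Inl v)" P2] by blast
  have \<pi>_neq: "\<pi> i \<noteq> \<pi> j" if "i \<noteq> j" "i < k" "j < k" for i j
    using inj_onD[OF \<pi>(1)] that by auto
  \<comment> \<open>The shared vertex \<open>v\<close> takes its color from \<open>c1\<close>; since
    \<pi> maps \<open>c2 (Inl v)\<close> to \<open>c1 (Inl v)\<close>, the formula of the second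
    side is valid there too.\<close>
  define c where "c x = (if x \<in> insert v A <+> edges (part A) then c1 x else \<pi> (c2 x))" for x
  have cA: "c (Inl x) = c1 (Inl x)" if "x \<in> insert v A" for x
    using that by (auto simp: c_def)
  have cB: "c (Inl x) = \<pi> (c2 (Inl x))" if "x \<in> insert v B" for x
    using that AB(3) \<pi>(3) by (auto simp: c_def)
  have cA': "c (Inr e) = c1 (Inr e)" if "e \<in> edges (part A)" for e
    using that by (auto simp: c_def)
  have cB': "c (Inr e) = \<pi> (c2 (Inr e))" if "e \<in> edges (part B)" for e
    using that disj by (auto simp: c_def)
  \<comment> \<open>Edges of different parts can meet only in \<open>v\<close>, where the permuted
    colors avoid those of the first side.\<close>
  have cross: "c (Inr e) \<noteq> c (Inr f)"
    if "e \<in> edges (part A)" "f \<in> edges (part B)" "e \<inter> f \<noteq> {}" for e f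
  proof -
    have "e \<inter> f \<subseteq> {v}" using that AB(3) unfolding part by blast
    then have "v \<in> e" "v \<in> f" using that by auto
    then have "c1 (Inr e) \<in> P1" "\<pi> (c2 (Inr f)) \<in> \<pi> ` P2"
      using that unfolding P1_def P2_def D1_def D2_def by auto
    then have "c1 (Inr e) \<noteq> \<pi> (c2 (Inr f))" using \<pi>(4) by (metis disjoint_iff)
    then show ?thesis using cA'[OF that(1)] cB'[OF that(2)] by simp
  qed
  have "total_coloring H c"
  proof (rule total_coloringI)
    fix x y assume "{x, y} \<in> edges H"
    then consider "{x, y} \<in> edges (part A)" | "{x, y} \<in> edges (part B)" using split by blast
    then show "c (Inl x) \<noteq> c (Inl y)"
    proof cases
      case 1
      then have "x \<in> insert v A" "y \<in> insert v A" unfolding part by auto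
      then show ?thesis using total_coloringD(1)[OF c1(1) _ _ 1] cA part(1) by simp
    next
      case 2
      then have *: "x \<in> insert v B" "y \<in> insert v B" unfolding part by auto
      then have "c2 (Inl x) \<noteq> c2 (Inl y)" using total_coloringD(1)[OF c2(1) _ _ 2] part(1) by simp
      then show ?thesis using * range2 \<pi>_neq cB by metis
    qed
  next
    fix e f assume ef: "e \<in> edges H" "f \<in> edges H" "e \<noteq> f" "e \<inter> f \<noteq> {}"
    consider "e \<in> edges (part A)" "f \<in> edges (part A)" | "e \<in> edges (part B)" "f \<in> edges (part B)"
      | "e \<in> edges (part A)" "f \<in> edges (part B)" | "e \<in> edges (part B)" "f \<in> edges (part A)"
      using split ef by blast
    then show "c (Inr e) \<noteq> c (Inr f)"
    proof cases
      case 1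
      then show ?thesis using total_coloringD(2)[OF c1(1) 1 ef(3,4)] cA' by simp
    next
      case 2
      then show ?thesis using total_coloringD(2)[OF c2(1) 2 ef(3,4)] cB' range2' \<pi>_neq by metis
    next
      case 3
      then show ?thesis using cross ef by blast
    next
      case 4
      then show ?thesis using cross[OF 4(2,1)] ef by (metis Int_commute)
    qed
  next
    fix e x assume e: "e \<in> edges H" "x \<in> e"
    then consider "e \<in> edges (part A)" | "e \<in> edges (part B)" using split by blast
    then show "c (Inl x) \<noteq> c (Inr e)"
    proof cases
      case 1
      then have "x \<in> insert v A" using e unfolding part by auto
      then show ?thesis using total_coloringD(3)[OF c1(1) 1 e(2)] cA cA' 1 by simp
    next
      case 2
      then have "x \<in> insert v B" using e unfolding part by auto
      then show ?thesis
        using total_coloringD(3)[OF c2(1) 2 e(2)] cB cB' 2 range2 range2' \<pi>_neq by metis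
    qed
  qed
  moreover have "c ` (verts H <+> edges H) \<subseteq> {..<k}"
  proof
    fix i assume "i \<in> c ` (verts H <+> edges H)"
    then consider x where "i = c (Inl x)" "x \<in> insert v A" | x where "i = c (Inl x)" "x \<in> insert v B"
      | e where "i = c (Inr e)" "e \<in> edges (part A)" | e where "i = c (Inr e)" "e \<in> edges (part B)"
      using split AB(5) by blast
    then show "i \<in> {..<k}"
    proof cases
      case 1
      then show ?thesis using cA range1 by simp
    next
      case 2
      then show ?thesis using cB range2 \<pi>(2) by fastforce
    next
      case 3
      then show ?thesis using cA' range1' by simp
    next
      case 4
      then show ?thesis using cB' range2' \<pi>(2) by fastforce
    qed
  qed
  ultimately have "total_colorable H k" unfolding total_colorable_def by blast
  then show False using H unfolding critical_def by blast
qed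

text \<open>Color \<open>{u, w}\<close> last but one and recolor \<open>u\<close> last: \<open>u\<close> sees at most \<open>2 * degree H u\<close> colors.\<close>

lemma critical_degree_sum:
  assumes H: "critical H k" and e: "{u, w} \<in> edges H" and u: "2 * degree H u < k"
  shows "k < degree H u + degree H w"
proof (rule ccontr)
  assume less: "\<not> ?thesis"
  have simple: "simple_graph H" using H unfolding critical_def by blast
  note uw = simple_graph_doubleton[OF simple e]
  let ?e = "{u, w}" and ?H = "delete_edge H {u, w}"
  have "subgraph ?H H" using simple unfolding subgraph_def simple_graph_def delete_edge_def by auto
  moreover have "?H \<noteq> H"
  proof
    assume "?H = H"
    then have "edges ?H = edges H" by simp
    then show False using e unfolding delete_edge_def by auto
  qed
  ultimately obtain c where c: "total_coloring ?H c" "c ` (verts ?H <+> edges ?H) \<subseteq> {..<k}"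
    using H unfolding critical_def total_colorable_def by blast
  have sel: "verts ?H = verts H" "edges ?H = edges H - {?e}" unfolding delete_edge_def by auto
  define D where "D x = {f \<in> edges H. x \<in> f} - {?e}" for x
  have finD: "finite (D x)" for x using simple_graph_finite_edges[OF simple] unfolding D_def by auto
  have cardD: "Suc (card (D x)) = degree H x" if "x \<in> ?e" for x
    unfolding D_def degree_def
    by (rule card_Suc_Diff1) (use e that simple_graph_finite_edges[OF simple] in auto)
  define N where "N = {x. {u, x} \<in> edges H}"
  note N = neighbours_card_le[OF simple, of u, folded N_def]
  let ?cr = "\<lambda>f. c (Inr f)" and ?cl = "\<lambda>x. c (Inl x)"
  \<comment> \<open>The new color \<open>a\<close> of \<open>{u, w}\<close> avoids the color of
    \<open>w\<close> and those of the other edges at \<open>u\<close> and \<open>w\<close>, at most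
    \<open>degree H u + degree H w - 1\<close> colors. The color of \<open>u\<close> may be ignored,
    because \<open>u\<close> is recolored afterwards.\<close>
  have "card (insert (c (Inl w)) (?cr ` D u \<union> ?cr ` D w)) \<le> Suc (card (D u) + card (D w))"
    using card_insert_le_m1 card_Un_le[of "?cr ` D u" "?cr ` D w"]
      card_image_le[OF finD, of ?cr u] card_image_le[OF finD, of ?cr w]
    by (intro order_trans[OF card_insert_le_m1]) auto
  then have "card (insert (c (Inl w)) (?cr ` D u \<union> ?cr ` D w)) < k"
    using less cardD[of u] cardD[of w] by simp
  then obtain a where a: "a < k" "a \<notin> insert (c (Inl w)) (?cr ` D u \<union> ?cr ` D w)"
    using free_color finD by (metis finite_Un finite_imageI finite_insert)
  \<comment> \<open>The new color \<open>b\<close> of \<open>u\<close> avoids \<open>a\<close>, the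
    neighbors of \<open>u\<close> and its other edges, at most \<open>2 * degree H u\<close>
    colors.\<close>
  have "card (insert a (?cl ` N \<union> ?cr ` D u)) \<le> Suc (card N + card (D u))"
    using card_Un_le[of "?cl ` N" "?cr ` D u"]
      card_image_le[OF finD, of ?cr u] card_image_le[OF N(1), of ?cl]
    by (intro order_trans[OF card_insert_le_m1]) auto
  then have "card (insert a (?cl ` N \<union> ?cr ` D u)) < k"
    using u cardD[of u] N(2) by simp
  then obtain b where b: "b < k" "b \<notin> insert a (?cl ` N \<union> ?cr ` D u)"
    using free_color finD N(1) by (metis finite_Un finite_imageI finite_insert)
  define d where "d = c(Inr ?e := a, Inl u := b)"
  have d: "d (Inr f) = (if f = ?e then a else c (Inr f))"
    "d (Inl x) = (if x = u then b else c (Inl x))" for f x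
    unfolding d_def by auto
  have bN: "b \<noteq> c (Inl x)" if "{u, x} \<in> edges H" for x using b that unfolding N_def by blast
  have bD: "b \<noteq> c (Inr f)" if "f \<in> edges H" "f \<noteq> ?e" "u \<in> f" for f
    using b that unfolding D_def by blast
  have aD: "a \<noteq> c (Inr f)" if "f \<in> edges H" "f \<noteq> ?e" "f \<inter> ?e \<noteq> {}" for f
  proof -
    have "f \<in> D u \<union> D w" using that unfolding D_def by blast
    then show ?thesis using a(2) by blast
  qed
  have "total_coloring H d"
  proof (rule total_coloringI)
    fix x y assume xy: "x \<in> verts H" "y \<in> verts H" "{x, y} \<in> edges H"
    note neq = simple_graph_doubleton[OF simple xy(3)]
    consider "x = u" | "y = u" | "x \<noteq> u" "y \<noteq> u" by blast
    then show "d (Inl x) \<noteq> d (Inl y)"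
    proof cases
      case 1
      then show ?thesis using bN[of y] xy neq d by auto
    next
      case 2
      then show ?thesis using bN[of x] xy neq d by (metis insert_commute)
    next
      case 3
      then have "{x, y} \<noteq> ?e" by (metis doubleton_eq_iff)
      then show ?thesis using total_coloringD(1)[OF c(1), of x y] xy 3 sel d by simp
    qed
  next
    fix f g assume fg: "f \<in> edges H" "g \<in> edges H" "f \<noteq> g" "f \<inter> g \<noteq> {}"
    consider "f = ?e" | "g = ?e" | "f \<noteq> ?e" "g \<noteq> ?e" by blast
    then show "d (Inr f) \<noteq> d (Inr g)"
    proof cases
      case 1
      then show ?thesis using aD[of g] fg d by (metis Int_commute)
    next
      case 2
      then show ?thesis using aD[of f] fg d by metis
    next
      case 3
      then show ?thesis using total_coloringD(2)[OF c(1), of f g] fg sel d by simp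
    qed
  next
    fix f x assume f: "f \<in> edges H" "x \<in> f"
    consider "f = ?e" "x = u" | "f = ?e" "x = w" | "f \<noteq> ?e" "x = u" | "f \<noteq> ?e" "x \<noteq> u"
      using f by blast
    then show "d (Inl x) \<noteq> d (Inr f)"
    proof cases
      case 1
      then show ?thesis using b d by simp
    next
      case 2
      then show ?thesis using a d uw by auto
    next
      case 3
      then show ?thesis using bD f d by simp
    next
      case 4
      then show ?thesis using total_coloringD(3)[OF c(1), of f x] f sel d by simp
    qed
  qed
  moreover have "d ` (verts H <+> edges H) \<subseteq> {..<k}"
  proof
    fix i assume "i \<in> d ` (verts H <+> edges H)"
    then consider x where "i = d (Inl x)" "x \<in> verts H" | f where "i = d (Inr f)" "f \<in> edges H"
      by blast
    then show "i \<in> {..<k}"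
    proof cases
      case 1
      have "c (Inl x) < k" using 1 c(2) sel(1) by blast
      then show ?thesis using 1 b d by simp
    next
      case 2
      have "c (Inr f) < k" if "f \<noteq> ?e" using 2 that c(2) sel(2) by blast
      then show ?thesis using 2 a d by simp
    qed
  qed
  ultimately have "total_colorable H k" unfolding total_colorable_def by blast
  then show False using H unfolding critical_def by blast
qed

section \<open>Four colors when all edges join vertices of degree two\<close>

lemma four_colors:
  obtains a :: nat where "a < 4" "a \<noteq> x" "a \<noteq> y" "a \<noteq> z"
proof -
  have "card {x, y, z} < 4" by (simp add: card_insert_if)
  then show ?thesis using free_color[of "{x, y, z}" 4] that by auto
qed

text \<open>Each corner of the triangle has two forbidden colors. If \<open>p = q\<close>, the
  corner \<open>u\<close> has only one, and choosing \<open>a\<close>, \<open>b\<close>,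
  \<open>u\<close> in this order works. Otherwise \<open>p\<close> is admissible for
  \<open>b\<close> and already forbidden for the other two, so giving it to \<open>b\<close> costs
  them nothing.\<close>

lemma triangle_list_coloring:
  fixes p :: nat
  assumes "p < 4" "p \<noteq> r" "q \<noteq> r"
  obtains a b u where "a < 4" "b < 4" "u < 4" "a \<noteq> b" "a \<noteq> u" "b \<noteq> u"
    "a \<notin> {p, s}" "b \<notin> {q, r}" "u \<notin> {p, q}"
proof (cases "p = q")
  case True
  obtain a where a: "a < 4" "a \<noteq> p" "a \<noteq> s" using four_colors by metis
  obtain b where b: "b < 4" "b \<noteq> q" "b \<noteq> r" "b \<noteq> a" using four_colors by metis
  obtain u where u: "u < 4" "u \<noteq> p" "u \<noteq> a" "u \<noteq> b" using four_colors by metis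
  show ?thesis using that[of a b u] a b u True by auto
next
  case False
  obtain a where a: "a < 4" "a \<noteq> p" "a \<noteq> s" using four_colors by metis
  obtain u where u: "u < 4" "u \<noteq> p" "u \<noteq> q" "u \<noteq> a" using four_colors by metis
  show ?thesis using that[of a p u] assms a u False by auto
qed

lemma degree_two_edges:
  assumes "simple_graph G" "degree G x = 2" "e \<in> edges G" "x \<in> e"
  obtains y where "{x, y} \<noteq> e" "y \<noteq> x" "y \<in> verts G" "{f \<in> edges G. x \<in> f} = {e, {x, y}}"
proof -
  have "card {f \<in> edges G. x \<in> f} = 2" using assms(2) unfolding degree_def .
  then obtain f g where fg: "{f \<in> edges G. x \<in> f} = {f, g}" "f \<noteq> g" unfolding card_2_iff by auto
  have "e \<in> {f, g}" unfolding fg(1)[symmetric] using assms by simp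
  then obtain h where h: "{f \<in> edges G. x \<in> f} = {e, h}" "h \<noteq> e"
    using fg by (metis insertE insert_commute singletonD)
  have "h \<in> {f \<in> edges G. x \<in> f}" unfolding h(1) by simp
  then obtain y where "h = {x, y}" "y \<noteq> x" "y \<in> verts G" using edge_exE[OF assms(1)] by blast
  then show ?thesis using that[of y] h by simp
qed

text \<open>Remove \<open>u\<close>, where \<open>x\<close>, \<open>u\<close>, \<open>y\<close> are consecutive, recolor \<open>x\<close> away from the color \<open>r\<close> of the
  second edge at \<open>y\<close>, and color the triangle \<open>u\<close>, \<open>{u, x}\<close>, \<open>{u, y}\<close> of the total graph.\<close>

lemma critical_two_regular_False:
  assumes H: "critical H 4" and deg: "\<And>v e. e \<in> edges H \<Longrightarrow> v \<in> e \<Longrightarrow> degree H v = 2"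
  shows False
proof -
  have simple: "simple_graph H" using H unfolding critical_def by blast
  obtain e where e: "e \<in> edges H" using critical_edges_nonempty[OF H] by auto
  then have "card e = 2" using simple unfolding simple_graph_def by blast
  then obtain u x where e_eq: "e = {u, x}" "u \<noteq> x" unfolding card_2_iff by auto
  have uV: "u \<in> verts H" "x \<in> verts H" using simple_graph_doubleton[OF simple] e e_eq by auto
  let ?a = "{u, x}"
  have a: "?a \<in> edges H" using e e_eq by simp
  have du: "degree H u = 2" using deg[OF e] e_eq by simp
  obtain y where y: "{u, y} \<noteq> ?a" "y \<noteq> u" "y \<in> verts H"
      "{f \<in> edges H. u \<in> f} = {?a, {u, y}}"
    by (rule degree_two_edges[OF simple du a]) simp_all
  let ?b = "{u, y}"
  have "?b \<in> {f \<in> edges H. u \<in> f}" unfolding y(4) by simp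
  then have b: "?b \<in> edges H" by simp
  have xy: "x \<noteq> y" using y(1) by auto
  have dx: "degree H x = 2" using deg[OF e] e_eq by simp
  obtain x' where x': "{x, x'} \<noteq> ?a" "x' \<noteq> x" "x' \<in> verts H"
      "{f \<in> edges H. x \<in> f} = {?a, {x, x'}}"
    by (rule degree_two_edges[OF simple dx a]) simp_all
  have dy: "degree H y = 2" using deg[OF b] by simp
  obtain y' where y': "{y, y'} \<noteq> ?b" "y' \<noteq> y" "y' \<in> verts H"
      "{f \<in> edges H. y \<in> f} = {?b, {y, y'}}"
    by (rule degree_two_edges[OF simple dy b]) simp_all
  let ?f = "{x, x'}" and ?g = "{y, y'}"
  have "?f \<in> {f \<in> edges H. x \<in> f}" unfolding x'(4) by simp
  then have f: "?f \<in> edges H" by simp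
  have "?g \<in> {f \<in> edges H. y \<in> f}" unfolding y'(4) by simp
  then have g: "?g \<in> edges H" by simp
  have uf: "x' \<noteq> u" "y' \<noteq> u" using x'(1) y'(1) by auto
  let ?H = "delete_vertex H u"
  have sel: "verts ?H = verts H - {u}" "edges ?H = {f \<in> edges H. u \<notin> f}"
    unfolding delete_vertex_def by auto
  have "subgraph ?H H"
    using simple_graph_delete_vertex[OF simple] unfolding subgraph_def sel by auto
  moreover have "?H \<noteq> H" using uV sel(1) by (metis Diff_iff singletonI)
  ultimately obtain c where c: "total_coloring ?H c" "c ` (verts ?H <+> edges ?H) \<subseteq> {..<4}"
    using H unfolding critical_def total_colorable_def by blast
  have f': "?f \<in> edges ?H" and g': "?g \<in> edges ?H" using f g uf e_eq(2) y(2) unfolding sel by auto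
  \<comment> \<open>After the removal of \<open>u\<close>, the vertex \<open>x\<close> has only the
    neighbor \<open>x'\<close> and the edge \<open>?f\<close>. One of the four colors therefore also
    avoids \<open>?g\<close>, which is the condition \<open>p \<noteq> r\<close> for the
    triangle.\<close>
  obtain p where p: "p < 4" "p \<noteq> c (Inr ?f)" "p \<noteq> c (Inl x')" "p \<noteq> c (Inr ?g)"
    using four_colors by metis
  have qr: "c (Inl y) \<noteq> c (Inr ?g)" using total_coloringD(3)[OF c(1) g', of y] by simp
  obtain i j l where ijl: "i < 4" "j < 4" "l < 4" "i \<noteq> j" "i \<noteq> l" "j \<noteq> l"
      "i \<notin> {p, c (Inr ?f)}" "j \<notin> {c (Inl y), c (Inr ?g)}" "l \<notin> {p, c (Inl y)}"
    using triangle_list_coloring[OF p(1,4) qr, of "c (Inr ?f)"] by metis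
  define d where "d = c(Inl x := p, Inr ?a := i, Inr ?b := j, Inl u := l)"
  have dl: "d (Inl z) = (if z = u then l else if z = x then p else c (Inl z))" for z
    unfolding d_def by simp
  have dr: "d (Inr h) = (if h = ?b then j else if h = ?a then i else c (Inr h))" for h
    unfolding d_def by simp
  have cases: "h = ?a \<or> h = ?b \<or> h \<in> edges ?H \<and> h \<noteq> ?a \<and> h \<noteq> ?b" if "h \<in> edges H" for h
  proof (cases "u \<in> h")
    case True
    then have "h \<in> {?a, ?b}" unfolding y(4)[symmetric] using that by simp
    then show ?thesis by blast
  next
    case False
    then show ?thesis using that unfolding sel by auto
  qed
  have at_x: "h = ?f" if "h \<in> edges ?H" "x \<in> h" for h
  proof -
    have "h \<in> {?a, ?f}" unfolding x'(4)[symmetric] using that unfolding sel by simp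
    then show ?thesis using that unfolding sel by auto
  qed
  have at_y: "h = ?g" if "h \<in> edges ?H" "y \<in> h" for h
  proof -
    have "h \<in> {?b, ?g}" unfolding y'(4)[symmetric] using that unfolding sel by simp
    then show ?thesis using that unfolding sel by auto
  qed
  \<comment> \<open>Among the vertices only \<open>u\<close> and \<open>x\<close> may have new
    colors, so only edges at these need a new argument.\<close>
  have vert: "d (Inl v) \<noteq> d (Inl w)" if vw: "{v, w} \<in> edges H" "v \<in> {u, x}" for v w
  proof -
    note neq = simple_graph_doubleton[OF simple vw(1)]
    consider "{v, w} = ?a" | "{v, w} = ?b" | "{v, w} \<in> edges ?H" using cases vw by blast
    then show ?thesis
    proof cases
      case 1
      then show ?thesis using neq dl ijl by (auto simp: doubleton_eq_iff)
    next
      case 2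
      then show ?thesis using neq dl ijl vw xy y(2) e_eq(2) by (auto simp: doubleton_eq_iff)
    next
      case 3
      then have vx: "v = x" using vw(2) unfolding sel by auto
      then have "{x, w} = ?f" using at_x 3 by auto
      then have "w = x'" by (auto simp: doubleton_eq_iff)
      then show ?thesis using vx dl p uf x'(2) e_eq(2) by auto
    qed
  qed
  have edge_a: "d (Inr ?a) \<noteq> d (Inr h)" if h: "h \<in> edges H" "h \<noteq> ?a" "h \<inter> ?a \<noteq> {}" for h
  proof -
    consider "h = ?b" | "h \<in> edges ?H" "h \<noteq> ?b" using cases[OF h(1)] h(2) by blast
    then show ?thesis
    proof cases
      case 1
      then show ?thesis using dr y(1) ijl by auto
    next
      case 2
      then have "x \<in> h" using h(3) unfolding sel by auto
      then have "h = ?f" using at_x 2 by blast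
      then show ?thesis using dr[of ?a] dr[of h] ijl y(1) h(2) 2(2) by simp
    qed
  qed
  have edge_b: "d (Inr ?b) \<noteq> d (Inr h)" if h: "h \<in> edges H" "h \<noteq> ?b" "h \<inter> ?b \<noteq> {}" for h
  proof -
    consider "h = ?a" | "h \<in> edges ?H" "h \<noteq> ?a" using cases[OF h(1)] h(2) by blast
    then show ?thesis
    proof cases
      case 1
      then show ?thesis using dr y(1) ijl by auto
    next
      case 2
      then have "y \<in> h" using h(3) unfolding sel by auto
      then have "h = ?g" using at_y 2 by blast
      then show ?thesis using dr[of ?b] dr[of h] ijl h(2) 2(2) by simp
    qed
  qed
  have "total_coloring H d"
  proof (rule total_coloringI)
    fix v w assume vw: "{v, w} \<in> edges H"
    consider "v \<in> {u, x}" | "w \<in> {u, x}" | "v \<notin> {u, x}" "w \<notin> {u, x}" by blast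
    then show "d (Inl v) \<noteq> d (Inl w)"
    proof cases
      case 1
      then show ?thesis using vert vw by blast
    next
      case 2
      then show ?thesis using vert[of w v] vw by (metis insert_commute)
    next
      case 3
      have "{v, w} \<in> edges ?H" using 3 vw unfolding sel by auto
      moreover have "v \<in> verts ?H" "w \<in> verts ?H"
        using 3 simple_graph_doubleton[OF simple vw] unfolding sel by auto
      ultimately have "c (Inl v) \<noteq> c (Inl w)" using total_coloringD(1)[OF c(1)] by blast
      then show ?thesis using 3 dl by auto
    qed
  next
    fix h h' assume hh: "h \<in> edges H" "h' \<in> edges H" "h \<noteq> h'" "h \<inter> h' \<noteq> {}"
    consider "h = ?a" | "h' = ?a" | "h = ?b" | "h' = ?b"
      | "h \<in> edges ?H" "h' \<in> edges ?H" "h \<noteq> ?a" "h \<noteq> ?b" "h' \<noteq> ?a" "h' \<noteq> ?b"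
      using cases[OF hh(1)] cases[OF hh(2)] by argo
    then show "d (Inr h) \<noteq> d (Inr h')"
    proof cases
      case 1
      then show ?thesis using edge_a[of h'] hh by (metis Int_commute)
    next
      case 2
      then show ?thesis using edge_a[of h] hh by metis
    next
      case 3
      then show ?thesis using edge_b[of h'] hh by (metis Int_commute)
    next
      case 4
      then show ?thesis using edge_b[of h] hh by metis
    next
      case 5
      then show ?thesis using total_coloringD(2)[OF c(1) 5(1,2) hh(3,4)] dr by simp
    qed
  next
    fix h v assume h: "h \<in> edges H" "v \<in> h"
    consider "h = ?a" | "h = ?b" | "h \<in> edges ?H" "h \<noteq> ?a" "h \<noteq> ?b" using cases[OF h(1)] by blast
    then show "d (Inl v) \<noteq> d (Inr h)"
    proof cases
      case 1
      then have "d (Inr h) = i" using dr[of h] y(1) by metis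
      moreover have "v = u \<or> v = x" using 1 h by simp
      ultimately show ?thesis using dl[of v] ijl by auto
    next
      case 2
      then have "d (Inr h) = j" using dr[of h] by simp
      moreover have "v = u \<or> v = y" using 2 h by simp
      ultimately show ?thesis using dl[of v] ijl xy y(2) by auto
    next
      case 3
      have vu: "v \<noteq> u" using 3 h unfolding sel by auto
      have hc: "d (Inr h) = c (Inr h)" using 3 dr by simp
      show ?thesis
      proof (cases "v = x")
        case True
        then have "h = ?f" using at_x 3 h by blast
        then show ?thesis using True hc dl p e_eq(2) by auto
      next
        case False
        then show ?thesis using total_coloringD(3)[OF c(1) 3(1) h(2)] hc vu dl by simp
      qed
    qed
  qed
  moreover have "d ` (verts H <+> edges H) \<subseteq> {..<4}"
  proof
    fix n assume "n \<in> d ` (verts H <+> edges H)"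
    then consider v where "n = d (Inl v)" "v \<in> verts H" | h where "n = d (Inr h)" "h \<in> edges H"
      by blast
    then show "n \<in> {..<4}"
    proof cases
      case 1
      have "c (Inl v) < 4" if "v \<noteq> u" using 1 that c(2) sel(1) by auto
      then show ?thesis using 1 p ijl dl by auto
    next
      case 2
      have "c (Inr h) < 4" if "h \<in> edges ?H" using that c(2) by auto
      then show ?thesis using 2 ijl dr cases[OF 2(2)] by auto
    qed
  qed
  ultimately have "total_colorable H 4" unfolding total_colorable_def by blast
  then show False using H unfolding critical_def by blast
qed

text \<open>Take a vertex \<open>x\<close> of \<open>V - {v}\<close> and a union \<open>C\<close> of components of \<open>V - {v, x}\<close>, with \<open>C\<close> as small as
  possible. It contains a neighbor \<open>s\<close> of \<open>v\<close>; if \<open>V - {v, s}\<close> were disconnected, then a part of it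
  would be a smaller choice for \<open>C\<close>.\<close>

lemma exists_noncut_neighbour:
  assumes conn: "\<And>x. x \<in> V \<Longrightarrow> connected_in E (V - {x})"
    and v: "v \<in> V" and w: "w \<in> V" "w \<noteq> v" "{v, w} \<in> E" and fin: "finite V"
  obtains y where "y \<in> V" "y \<noteq> v" "{v, y} \<in> E" "connected_in E (V - {v, y})"
proof -
  \<comment> \<open>\<open>P C x\<close> says that \<open>C\<close> is a nonempty proper union of
    components of the graph induced on \<open>V - {v, x}\<close>.\<close>
  define P where "P C x \<longleftrightarrow> x \<in> V \<and> x \<noteq> v \<and> C \<noteq> {} \<and> C \<subseteq> V - {v, x} \<and> C \<noteq> V - {v, x} \<and>
    (\<forall>a\<in>C. \<forall>b\<in>V - {v, x} - C. {a, b} \<notin> E)" for C x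
  have PI: "\<exists>C. P C x" if "\<not> connected_in E (V - {v, x})" "x \<in> V" "x \<noteq> v" for x
    using that unfolding P_def connected_in_def by auto
  have descent: "\<exists>y\<in>V - {v}. {v, y} \<in> E \<and> connected_in E (V - {v, y})" if "P C x" for C x
    using that
  proof (induction "card C" arbitrary: C x rule: less_induct)
    case less
    have x: "x \<in> V" "x \<noteq> v" and C: "C \<noteq> {}" "C \<subseteq> V - {v, x}" "C \<noteq> V - {v, x}"
      and sep: "\<And>a b. a \<in> C \<Longrightarrow> b \<in> V - {v, x} - C \<Longrightarrow> {a, b} \<notin> E"
      using less.prems unfolding P_def by auto
    \<comment> \<open>Since \<open>V - {x}\<close> is connected, some edge leaves \<open>C\<close>
      in it, and \<open>v\<close> is the only vertex that it can reach.\<close>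
    have "C \<subseteq> V - {x}" "C \<noteq> V - {x}" using C v x by auto
    then obtain s b where "s \<in> C" "b \<in> V - {x} - C" "{s, b} \<in> E"
      using connected_inD[OF conn[OF x(1)]] C(1) by metis
    moreover from this have "b = v" using sep[of s b] by auto
    ultimately have s: "s \<in> C" "{v, s} \<in> E" by (simp_all add: insert_commute)
    have sV: "s \<in> V" "s \<noteq> v" "s \<noteq> x" using s C by auto
    show ?case
    proof (cases "connected_in E (V - {v, s})")
      case True
      then show ?thesis using s sV by auto
    next
      case False
      then obtain A where A: "P A s" using PI sV by metis
      have "{a, b} \<notin> E" if "a \<in> V - {v, s} - A" "b \<in> A" for a b
        using A that unfolding P_def by (metis insert_commute)
      then have "P (V - {v, s} - A) s" using A unfolding P_def by auto
      moreover have "x \<notin> A \<or> x \<notin> V - {v, s} - A" by simp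
      \<comment> \<open>Both \<open>A\<close> and its complement in \<open>V - {v, s}\<close> are
        separated parts, so one of them misses \<open>x\<close>.\<close>
      ultimately obtain B where B: "P B s" "x \<notin> B" using A by metis
      have B': "B \<noteq> {}" "B \<subseteq> V - {v, s}"
        and Bsep: "\<And>a b. a \<in> B \<Longrightarrow> b \<in> V - {v, s} - B \<Longrightarrow> {a, b} \<notin> E"
        using B(1) unfolding P_def by auto
      \<comment> \<open>Since \<open>V - {v}\<close> is connected, some edge leaves \<open>B\<close>
        in it, necessarily to \<open>s\<close>. If \<open>B\<close> missed \<open>C\<close>, this
        edge would join \<open>s\<close> in \<open>C\<close> to a vertex outside \<open>C\<close>
        other than \<open>v\<close> and \<open>x\<close>.\<close>
      have "B \<inter> C \<noteq> {}"
      proof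
        assume disj: "B \<inter> C = {}"
        have "B \<subseteq> V - {v}" "B \<noteq> V - {v}" using B' sV by auto
        then obtain a b where ab: "a \<in> B" "b \<in> V - {v} - B" "{a, b} \<in> E"
          using connected_inD[OF conn[OF v]] B'(1) by metis
        then have "b = s" using Bsep[of a b] by auto
        moreover have "a \<in> V - {v, x} - C" using ab(1) B' B(2) disj by auto
        ultimately show False using sep[OF s(1)] ab(3) by (metis insert_commute)
      qed
      \<comment> \<open>If \<open>b\<close> is in \<open>B\<close>, then it differs from
        \<open>x\<close> and lies outside \<open>C\<close>, so the edge would cross
        \<open>C\<close>; otherwise it would cross \<open>B\<close>.\<close>
      moreover have "{a, b} \<notin> E" if "a \<in> B \<inter> C" "b \<in> V - {v, s} - B \<inter> C" for a b
      proof (cases "b \<in> B")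
        case True
        then have "b \<in> V - {v, x} - C" using that B(2) by auto
        then show ?thesis using sep[of a b] that by blast
      next
        case False
        then show ?thesis using Bsep[of a b] that by blast
      qed
      moreover have "B \<inter> C \<subseteq> V - {v, s}" "x \<in> V - {v, s} - B \<inter> C" using B' B(2) x sV by auto
      ultimately have "P (B \<inter> C) s" unfolding P_def using sV by blast
      \<comment> \<open>The vertex \<open>s\<close> is in \<open>C\<close> but not in
        \<open>B\<close>, so the new part is strictly smaller.\<close>
      moreover have "B \<inter> C \<subset> C" using s(1) B'(2) by auto
      then have "card (B \<inter> C) < card C"
        using C(2) fin by (meson finite_Diff finite_subset psubset_card_mono)
      ultimately show ?thesis using less.hyps by blast
    qed
  qed
  show ?thesis
  proof (cases "connected_in E (V - {v, w})")
    case True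
    then show ?thesis using that w by blast
  next
    case False
    then obtain C where "P C w" using PI w by metis
    then show ?thesis using descent that by (metis DiffE singletonI)
  qed
qed

section \<open>Clique minors in total graphs of critical graphs\<close>

definition star :: "'a graph \<Rightarrow> 'a \<Rightarrow> ('a + 'a set) set" where
  "star G v = insert (Inl v) (Inr ` {e \<in> edges G. v \<in> e})"

text \<open>Any two edges at \<open>v\<close> share \<open>v\<close>, so the star is a clique of the
  total graph and its singletons serve as branch sets.\<close>

lemma branch_sets_star:
  assumes simple: "simple_graph G" and v: "v \<in> verts G"
  shows "branch_sets (total_graph G) ((\<lambda>s. {s}) ` star G v)"
    and "finite ((\<lambda>s. {s}) ` star G v)"
    and "card ((\<lambda>s. {s}) ` star G v) = Suc (degree G v)"
proof -
  have adj: "{s, t} \<in> edges (total_graph G)" if st: "s \<in> star G v" "t \<in> star G v" "s \<noteq> t" for s t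
  proof -
    consider e where "s = Inl v" "t = Inr e" "e \<in> edges G" "v \<in> e"
      | e where "t = Inl v" "s = Inr e" "e \<in> edges G" "v \<in> e"
      | e f where "s = Inr e" "t = Inr f" "e \<in> edges G" "v \<in> e" "f \<in> edges G" "v \<in> f"
      using st unfolding star_def by auto
    then show ?thesis
    proof cases
      case 1
      then show ?thesis using total_graph_simps(4) by simp
    next
      case 2
      then show ?thesis using total_graph_simps(5) by simp
    next
      case 3
      then have "e \<noteq> f" "e \<inter> f \<noteq> {}" using st(3) by auto
      then show ?thesis using 3 total_graph_simps(3) by simp
    qed
  qed
  have "star G v \<subseteq> verts (total_graph G)"
    using v unfolding star_def total_graph_simps by auto
  then show "branch_sets (total_graph G) ((\<lambda>s. {s}) ` star G v)"
    unfolding branch_sets_def using adj by (auto simp: connected_in_singleton)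
  have fin: "finite (star G v)"
    using simple_graph_finite_edges[OF simple] unfolding star_def by simp
  then show "finite ((\<lambda>s. {s}) ` star G v)" by simp
  have "card (star G v) = Suc (card (Inr ` {e \<in> edges G. v \<in> e} :: ('a + 'a set) set))"
    using simple_graph_finite_edges[OF simple] unfolding star_def by (intro card_insert_disjoint) auto
  also have "\<dots> = Suc (degree G v)" unfolding degree_def by (simp add: card_image)
  finally have "card (star G v) = Suc (degree G v)" .
  then show "card ((\<lambda>s. {s}) ` star G v) = Suc (degree G v)" by (simp add: card_image)
qed

text \<open>The vertices other than \<open>v\<close> form a connected set because \<open>v\<close>
  is not a cut vertex. This set is adjacent to \<open>v\<close> through \<open>w\<close>, and to
  every edge at \<open>v\<close> through its other end.\<close>

lemma critical_branch_sets_one: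
  assumes H: "critical H k" and k: "max_degree H < k"
    and v: "v \<in> verts H" and w: "{v, w} \<in> edges H"
  obtains \<B> where "branch_sets (total_graph H) \<B>" "card \<B> = degree H v + 2"
proof -
  have simple: "simple_graph H" using H unfolding critical_def by blast
  have w': "w \<in> verts H" "w \<noteq> v" using simple_graph_doubleton[OF simple w] by auto
  let ?T = "total_graph H" and ?S = "(\<lambda>s. {s}) ` star H v" and ?W = "verts H - {v}"
  let ?B = "Inl ` ?W :: ('a + 'a set) set"
  note S = branch_sets_star[OF simple v]
  have "connected_in (edges ?T) ?B"
    using critical_no_cut_vertex[OF H k v]
    by (rule connected_in_image) (simp add: total_graph_simps)
  moreover have "?B \<noteq> {}" using w' by auto
  moreover have "?B \<subseteq> verts ?T" unfolding total_graph_simps by auto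
  moreover have disj: "?B \<inter> star H v = {}" unfolding star_def by auto
  moreover have "\<exists>x\<in>?B. {x, s} \<in> edges ?T" if s: "s \<in> star H v" for s
  proof -
    consider "s = Inl v" | e where "s = Inr e" "e \<in> edges H" "v \<in> e"
      using s unfolding star_def by auto
    then show ?thesis
    proof cases
      case 1
      have "{Inl w, s} \<in> edges ?T"
        unfolding 1 using w by (intro total_graph_simps(2)) (simp add: insert_commute)
      then show ?thesis using w' by blast
    next
      case 2
      obtain x where x: "e = {v, x}" "x \<noteq> v" "x \<in> verts H"
        using edge_exE[OF simple 2(2,3)] by blast
      have "{Inl x, s} \<in> edges ?T" unfolding 2(1) by (rule total_graph_simps(4)) (use 2 x in auto)
      then show ?thesis using x by blast
    qed
  qed
  ultimately have "branch_sets ?T (insert ?B ?S)"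
    using S(1) by (intro branch_sets_insert) auto
  moreover have "?B \<notin> ?S" using disj by fastforce
  then have "card (insert ?B ?S) = degree H v + 2" using S by simp
  ultimately show ?thesis using that by blast
qed

text \<open>One extra branch set consists of the vertices of \<open>H - v\<close>, the other of its edges. To make the
  latter adjacent to \<open>v\<close>, a neighbor \<open>y\<close> of \<open>v\<close> is exchanged for an edge \<open>f\<close> of \<open>H - v\<close> at \<open>y\<close>.\<close>

lemma critical_branch_sets_two:
  assumes H: "critical H k" and k: "max_degree H < k"
    and v: "v \<in> verts H" and w: "{v, w} \<in> edges H"
    and deg: "\<And>u e. e \<in> edges H \<Longrightarrow> u \<in> e \<Longrightarrow> degree H u \<ge> 3"
  obtains \<B> where "branch_sets (total_graph H) \<B>" "card \<B> = degree H v + 3"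
proof -
  have simple: "simple_graph H" using H unfolding critical_def by blast
  have w': "w \<in> verts H" "w \<noteq> v" using simple_graph_doubleton[OF simple w] by auto
  have fin: "finite (verts H)" using simple unfolding simple_graph_def by blast
  let ?T = "total_graph H" and ?S = "(\<lambda>s. {s}) ` star H v"
  obtain y where y: "y \<in> verts H" "y \<noteq> v" "{v, y} \<in> edges H"
    "connected_in (edges H) (verts H - {v, y})"
    using exists_noncut_neighbour[OF critical_no_cut_vertex[OF H k] v w' w fin] by blast
  let ?W = "verts H - {v, y}" and ?vy = "{v, y}"
  have off: "v \<notin> g" if "g \<noteq> {v, u}" "g \<in> edges H" "u \<in> g" "u \<noteq> v" for g u
    using edge_exE[OF simple that(2,3)] that by (metis insertE insert_commute singletonD)
  have card1: "card {?vy} < degree H y" and card2: "\<And>f. card {?vy, f} < degree H y"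
    using deg[OF y(3), of y] by (auto simp: card_insert_if)
  \<comment> \<open>Degree at least 3 at \<open>y\<close> yields two edges besides
    \<open>{v, y}\<close>: \<open>f\<close> joins the vertex set in exchange for \<open>y\<close>,
    and \<open>g\<close> keeps \<open>y\<close> attached to the edge set.\<close>
  obtain f where f: "f \<in> edges H" "y \<in> f" "f \<noteq> ?vy"
    using edge_outside[OF _ card1] by auto
  obtain g where g: "g \<in> edges H" "y \<in> g" "g \<noteq> ?vy" "g \<noteq> f"
    using edge_outside[OF _ card2[of f]] by auto
  have vf: "v \<notin> f" "v \<notin> g" using off[of f y] off[of g y] f g y by auto
  obtain z where z: "f = {y, z}" "z \<noteq> y" "z \<in> verts H" using edge_exE[OF simple f(1,2)] by blast
  obtain z' where z': "g = {y, z'}" "z' \<noteq> y" "z' \<in> verts H" using edge_exE[OF simple g(1,2)] by blast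
  have zW: "z \<in> ?W" "z' \<in> ?W" using z z' vf by auto
  define E where "E = {e \<in> edges H. v \<notin> e} - {f}"
  have gE: "g \<in> E" using g vf unfolding E_def by blast
  \<comment> \<open>Without \<open>f\<close>, the set \<open>B1\<close> would contain neither end of
    \<open>{v, y}\<close>; \<open>f\<close> is adjacent to that edge at \<open>y\<close>. Likewise
    \<open>y\<close> makes \<open>B2\<close> adjacent to \<open>v\<close>, which no edge of
    \<open>E\<close> contains.\<close>
  define B1 where "B1 = insert (Inr f) (Inl ` ?W :: ('a + 'a set) set)"
  define B2 where "B2 = insert (Inl y) (Inr ` E)"
  have "connected_in (edges ?T) (Inl ` ?W)"
    using y(4) by (rule connected_in_image) (simp add: total_graph_simps)
  then have conn1: "connected_in (edges ?T) B1"
    unfolding B1_def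
  proof (rule connected_in_insert)
    show "Inl z \<in> Inl ` ?W" using zW by blast
    show "{Inr f, Inl z} \<in> edges ?T" using f(1) z by (intro total_graph_simps(5)) auto
  qed
  \<comment> \<open>Since \<open>f\<close> contains \<open>y\<close>, its removal affects no edge
    inside \<open>?W\<close>; then \<open>y\<close> is attached through \<open>g\<close>.\<close>
  have "connected_in E ?W"
    by (rule connected_in_mono[OF y(4)]) (use f(2) in \<open>auto simp: E_def\<close>)
  then have "connected_in E (insert y ?W)"
    by (rule connected_in_insert[OF _ zW(2)]) (use gE z' in simp)
  then have "connected_in {{e, e'} | e e'. e \<in> E \<and> e' \<in> E \<and> e \<noteq> e' \<and> e \<inter> e' \<noteq> {}} E"
  proof (rule connected_in_edges)
    fix e assume "e \<in> E"
    then have "e \<subseteq> verts H" "v \<notin> e" "card e = 2"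
      using simple unfolding E_def simple_graph_def by auto
    then show "e \<subseteq> insert y ?W \<and> e \<noteq> {}" by auto
  qed blast
  then have "connected_in (edges ?T) (Inr ` E)"
  proof (rule connected_in_image)
    fix e e' assume "e \<in> E" "e' \<in> E"
      and ee: "{e, e'} \<in> {{e, e'} | e e'. e \<in> E \<and> e' \<in> E \<and> e \<noteq> e' \<and> e \<inter> e' \<noteq> {}}"
    then have "e \<in> edges H" "e' \<in> edges H" unfolding E_def by auto
    moreover have "e \<noteq> e'" "e \<inter> e' \<noteq> {}" using ee by (auto simp: doubleton_eq_iff)
    ultimately show "{Inr e, Inr e'} \<in> edges ?T" by (rule total_graph_simps(3))
  qed
  then have conn2: "connected_in (edges ?T) B2"
    unfolding B2_def
  proof (rule connected_in_insert)
    show "Inr g \<in> Inr ` E" using gE by blast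
    show "{Inl y, Inr g} \<in> edges ?T" using g by (intro total_graph_simps(4))
  qed
  have sub: "B1 \<subseteq> verts ?T" "B2 \<subseteq> verts ?T"
    using f(1) y(1) unfolding B1_def B2_def E_def total_graph_simps by auto
  have disj: "B1 \<inter> star H v = {}" "B2 \<inter> star H v = {}" "B2 \<inter> B1 = {}"
    using vf y(2) unfolding B1_def B2_def star_def E_def by auto
  have adj1: "\<exists>x\<in>B1. {x, s} \<in> edges ?T" if s: "s \<in> star H v" for s
  proof -
    consider "s = Inl v" | "s = Inr ?vy" | e where "s = Inr e" "e \<in> edges H" "v \<in> e" "e \<noteq> ?vy"
      using s unfolding star_def by auto
    then show ?thesis
    proof cases
      case 1
      \<comment> \<open>As \<open>y\<close> is missing from \<open>B1\<close>, a second neighbor of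
        \<open>v\<close> is called for.\<close>
      have "card {?vy} < degree H v" using deg[OF y(3), of v] by simp
      then obtain h where h: "h \<in> edges H" "v \<in> h" "h \<noteq> ?vy" using edge_outside[of "{?vy}"] by auto
      then obtain x where x: "h = {v, x}" "x \<noteq> v" "x \<in> verts H"
        using edge_exE[OF simple] by metis
      have "{Inl x, s} \<in> edges ?T"
        unfolding 1 using h x by (intro total_graph_simps(2)) (simp add: insert_commute)
      moreover have "Inl x \<in> B1" using x h(3) unfolding B1_def by auto
      ultimately show ?thesis by blast
    next
      case 2
      have "{Inr f, s} \<in> edges ?T"
        unfolding 2 using f y(3) by (intro total_graph_simps(3)) auto
      then show ?thesis unfolding B1_def by blast
    next
      case 3
      obtain x where x: "e = {v, x}" "x \<noteq> v" "x \<in> verts H"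
        using edge_exE[OF simple 3(2,3)] by blast
      have "{Inl x, s} \<in> edges ?T" unfolding 3(1) by (rule total_graph_simps(4)) (use 3 x in auto)
      moreover have "Inl x \<in> B1" using x 3(4) unfolding B1_def by auto
      ultimately show ?thesis by blast
    qed
  qed
  have adj2: "\<exists>x\<in>B2. {x, s} \<in> edges ?T" if s: "s \<in> star H v" for s
  proof -
    consider "s = Inl v" | "s = Inr ?vy" | e where "s = Inr e" "e \<in> edges H" "v \<in> e" "e \<noteq> ?vy"
      using s unfolding star_def by auto
    then show ?thesis
    proof cases
      case 1
      have "{Inl y, s} \<in> edges ?T"
        unfolding 1 using y(3) by (intro total_graph_simps(2)) (simp add: insert_commute)
      then show ?thesis unfolding B2_def by blast
    next
      case 2
      have "{Inl y, s} \<in> edges ?T" unfolding 2 using y(3) by (intro total_graph_simps(4)) auto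
      then show ?thesis unfolding B2_def by blast
    next
      case 3
      obtain x where x: "e = {v, x}" "x \<noteq> v" "x \<in> verts H"
        using edge_exE[OF simple 3(2,3)] by blast
      \<comment> \<open>Degree at least 3 at \<open>x\<close> yields an edge at \<open>x\<close>
        other than \<open>e\<close> and \<open>f\<close>. It avoids \<open>v\<close>, so it belongs
        to \<open>E\<close>.\<close>
      have "card {e, f} < degree H x" using deg[OF 3(2), of x] x by (simp add: card_insert_if)
      then obtain h where h: "h \<in> edges H" "x \<in> h" "h \<noteq> e" "h \<noteq> f"
        using edge_outside[of "{e, f}" H x] by auto
      then have "v \<notin> h" using off[of h x] x by auto
      then have "Inr h \<in> B2" using h unfolding B2_def E_def by blast
      moreover have "{Inr h, s} \<in> edges ?T"
        unfolding 3(1) using h 3(2) x by (intro total_graph_simps(3)) auto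
      ultimately show ?thesis by blast
    qed
  qed
  have adj12: "\<exists>x\<in>B2. \<exists>x'\<in>B1. {x, x'} \<in> edges ?T"
  proof -
    have "{Inl y, Inr f} \<in> edges ?T" using f by (intro total_graph_simps(4))
    then show ?thesis unfolding B1_def B2_def by blast
  qed
  note S = branch_sets_star[OF simple v]
  have ne: "B1 \<noteq> {}" "B2 \<noteq> {}" unfolding B1_def B2_def by auto
  have "branch_sets ?T (insert B1 ?S)"
    using S(1) ne(1) sub(1) conn1 by (rule branch_sets_insert) (use disj(1) adj1 in auto)
  then have "branch_sets ?T (insert B2 (insert B1 ?S))"
    using ne(2) sub(2) conn2 by (rule branch_sets_insert) (use disj(2,3) adj2 adj12 in auto)
  moreover have "B1 \<notin> ?S" "B2 \<notin> ?S" "B2 \<noteq> B1" using disj ne by auto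
  then have "card (insert B2 (insert B1 ?S)) = degree H v + 3" using S by simp
  ultimately show ?thesis using that by blast
qed

lemma critical_degree_ge_three:
  assumes H: "critical H (max_degree H + 2)" and e: "e \<in> edges H" "u \<in> e"
  shows "degree H u \<ge> 3"
proof -
  have simple: "simple_graph H" using H unfolding critical_def by blast
  have bounds: "degree H x \<le> max_degree H \<and> degree H x \<ge> 2 \<and>
      (max_degree H \<noteq> 2 \<longrightarrow> degree H x \<ge> 3)" if f: "f \<in> edges H" "x \<in> f" for f x
  proof -
    obtain w where w: "f = {x, w}" "w \<in> verts H" using edge_exE[OF simple f] by metis
    then have x: "x \<in> verts H" "{x, w} \<in> edges H" using simple_graph_doubleton[OF simple] f by auto
    have "{f \<in> edges H. x \<in> f} \<noteq> {}" using f by auto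
    then have "degree H x > 0"
      unfolding degree_def using simple_graph_finite_edges[OF simple] by (simp add: card_gt_0_iff)
    then show ?thesis
      using critical_degree_sum[OF H x(2)] degree_le_max_degree[OF simple x(1)]
        degree_le_max_degree[OF simple w(2)] by linarith
  qed
  have "max_degree H \<noteq> 2"
  proof
    assume \<Delta>: "max_degree H = 2"
    then have "critical H 4" using H by simp
    then show False using critical_two_regular_False bounds \<Delta> by (metis le_antisym)
  qed
  then show ?thesis using bounds[OF e] by blast
qed

text \<open>The star at a vertex of maximum degree has one element more than the maximum degree.
  This suffices for \<open>k\<close> up to the maximum degree; the next two values of
  \<open>k\<close> are met by one and by two additional branch sets.\<close>

lemma critical_branch_sets:
  assumes H: "critical H k" and k: "k \<le> max_degree H + 2"
  obtains \<B> where "branch_sets (total_graph H) \<B>" "card \<B> > k"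
proof -
  have simple: "simple_graph H" using H unfolding critical_def by blast
  obtain v where v: "v \<in> verts H" "degree H v = max_degree H"
    using max_degree_attained[OF simple critical_verts_nonempty[OF H]] by blast
  consider "k \<le> max_degree H" | "max_degree H < k" by linarith
  then show ?thesis
  proof cases
    case 1
    then show ?thesis using that[OF branch_sets_star(1)[OF simple v(1)]]
        branch_sets_star(3)[OF simple v(1)] v(2) by simp
  next
    case 2
    \<comment> \<open>Since \<open>k > 0\<close>, there is an edge. The maximum degree is thus
      positive, and \<open>v\<close>, which attains it, has a neighbor.\<close>
    obtain e where e: "e \<in> edges H" using critical_edges_nonempty[OF H] 2 by auto
    then have "card e = 2" using simple unfolding simple_graph_def by blast
    then obtain x where x: "x \<in> e" "x \<in> verts H"
      using e simple unfolding simple_graph_def by (metis card.empty equals0I subsetD zero_neq_numeral)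
    have "card {f \<in> edges H. x \<in> f} > 0"
      using e x simple_graph_finite_edges[OF simple] by (auto simp: card_gt_0_iff)
    then have "card {} < degree H v"
      using degree_le_max_degree[OF simple x(2)] v(2) unfolding degree_def by simp
    then obtain h where h: "h \<in> edges H" "v \<in> h" by (metis edge_outside finite.emptyI)
    then obtain w where w: "{v, w} \<in> edges H" using edge_exE[OF simple] by metis
    consider "k = max_degree H + 1" | "k = max_degree H + 2" using 2 k by linarith
    then show ?thesis
    proof cases
      case 1
      obtain \<B> where "branch_sets (total_graph H) \<B>" "card \<B> = degree H v + 2"
        using critical_branch_sets_one[OF H 2 v(1) w] by blast
      then show ?thesis using that[of \<B>] v(2) 1 by simp
    next
      case k2: 2
      obtain \<B> where "branch_sets (total_graph H) \<B>" "card \<B> = degree H v + 3"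
        using critical_branch_sets_two[OF H 2 v(1) w] critical_degree_ge_three H k2 by metis
      then show ?thesis using that[of \<B>] v(2) k2 by simp
    qed
  qed
qed

theorem theorem8:
  fixes F :: "'a graph set"
  assumes "\<forall>G\<in>F. simple_graph G"
    and "subgraph_closed F"
    and "\<forall>G\<in>F. total_chromatic_number G \<le> max_degree G + 3"
  shows "\<forall>G\<in>F. \<forall>t::nat. t > 0 \<longrightarrow> chromatic_number (total_graph G) \<ge> t \<longrightarrow>
           has_minor (total_graph G) (complete_graph t)"
proof (intro ballI allI impI)
  fix G and t :: nat
  assume G: "G \<in> F" and t: "t > 0" "chromatic_number (total_graph G) \<ge> t"
  have simple: "simple_graph G" using assms(1) G by blast
  \<comment> \<open>With \<open>t > 0\<close>, the subtraction is exact and \<open>t - 1\<close>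
    lies below the chromatic number.\<close>
  have "\<not> total_colorable G (t - 1)"
    using chromatic_number_total_graph_le[OF simple, of "t - 1"] t by linarith
  then obtain H where H: "subgraph H G" "critical H (t - 1)"
    using critical_subgraph[OF simple] by blast
  \<comment> \<open>Closure under subgraphs makes the assumed bound available with the maximum
    degree of \<open>H\<close> in place of that of \<open>G\<close>.\<close>
  have "H \<in> F" using assms(2) G H(1) unfolding subgraph_closed_def by blast
  then have "total_colorable H (max_degree H + 3)"
    using total_colorable_total_chromatic_number total_colorable_mono assms(1,3) by blast
  then have "\<not> max_degree H + 3 \<le> t - 1"
    using H(2) total_colorable_mono unfolding critical_def by blast
  then have "t - 1 \<le> max_degree H + 2" by linarith
  then obtain \<B> where \<B>: "branch_sets (total_graph H) \<B>" "card \<B> > t - 1"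
    using critical_branch_sets[OF H(2)] by blast
  then have "t \<le> card \<B>" by linarith
  then obtain \<C> where \<C>: "\<C> \<subseteq> \<B>" "card \<C> = t" by (rule obtain_subset_with_card_n)
  have "branch_sets (total_graph G) \<C>"
    using branch_sets_mono[OF branch_sets_subset[OF \<B>(1) \<C>(1)] total_graph_mono[OF H(1)]] .
  then show "has_minor (total_graph G) (complete_graph t)"
    using has_minor_complete_graph[OF simple_graph_total_graph[OF simple]] \<C>(2) by blast
qed

end
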